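(* Let $F:\mathbb{R}^2\to\mathbb{R}$, $F(x,y)=xy$, and let $\varepsilon>0$. Among parallelogram tilings, the optimal triangle density for continuous piecewise linear $\varepsilon$-overestimations (resp. $\varepsilon$-underestimations) of $F$ is $\frac{\sqrt3}{4\,\varepsilon}$; that is, in each case $\frac{\sqrt3}{4\varepsilon}$ is the infimum of $\delta(\mathcal T)$ over all parallelogram tilings $\mathcal T$ that admit such an overestimation (resp. underestimation). The optimal triangles have area $\frac{4\sqrt3}{3}\,\varepsilon$ and constant deviation $\Delta=\frac{2\varepsilon}{3}$ (for overestimation) or $\Delta=-\frac{2\varepsilon}{3}$ (for underestimation).
   Context: A triangle is the convex hull of three affinely independent points of $\mathbb{R}^2$. A triangulation of $\mathbb{R}^2$ is a locally finite family $\mathcal T$ of triangles covering $\mathbb{R}^2$ such that any two distinct members intersect in the empty set or in a common proper face (vertex or edge) of both. A parallelogram tiling is a triangulation of $\mathbb{R}^2$ consisting of translated copies of one triangle $T$ and of its point-reflection $T'=-T$, arranged so that $T$ and (a translate of) $T'$ form a parallelogram that tiles the plane by translation. A continuous piecewise linear $\varepsilon$-overestimation (resp. $\varepsilon$-underestimation) of $F$ with respect to $\mathcal T$ is a continuous function $f:\mathbb{R}^2\to\mathbb{R}$ that is affine on each triangle of $\mathcal T$ and satisfies $F\le f\le F+\varepsilon$ (resp. $F-\varepsilon\le f\le F$) on $\mathbb{R}^2$. The deviation of $f$ at a vertex $v$ of $\mathcal T$ is $f(v)-F(v)$; constant deviation $\Delta$ means that the deviation equals $\Delta$ at all vertices.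 The optimal triangles are the triangles of a parallelogram tiling attaining the optimal density, taken together with the corresponding function $f$. The triangle density of $\mathcal T$ is $\delta(\mathcal T)=\limsup_{\ell\to\infty}\frac{|\{S\in\mathcal T: S\cap Q_\ell\neq\emptyset\}|}{\ell^2}$, where $Q_\ell$ is the axis-parallel square of side length $\ell$ centered at the origin.
   Formalization: The constant deviation of optimal triangles is not unique: by mirroring, ε/3 (overestimation) or −ε/3 (underestimation) also occurs. It is proved that 2ε/3 (resp. −2ε/3) is attained and that every optimal pair has constant deviation equal to one of the two values. *)

theory Defs
  imports "HOL-Analysis.Analysis"
begin

section \<open>Triangulations and parallelogram tilings of the plane\<close>

abbreviation triangle :: "(real^2) set \<Rightarrow> bool"
  where "triangle S \<equiv> 2 simplex S"

definition triangulation :: "(real^2) set set \<Rightarrow> bool" where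
  "triangulation \<T> \<longleftrightarrow>
     (\<forall>S\<in>\<T>. triangle S) \<and>
     locally_finite_in euclidean \<T> \<and>
     \<Union>\<T> = UNIV \<and>
     (\<forall>S\<in>\<T>. \<forall>T\<in>\<T>. S \<noteq> T \<longrightarrow>
        S \<inter> T = {} \<or>
        ((S \<inter> T) face_of S \<and> (S \<inter> T) face_of T \<and> S \<inter> T \<noteq> S \<and> S \<inter> T \<noteq> T))"

definition parallelogram :: "(real^2) set \<Rightarrow> bool" where
  "parallelogram P \<longleftrightarrow>
     (\<exists>p u w. u \<noteq> w \<and> independent {u, w} \<and>
        P = {p + s *\<^sub>R u + t *\<^sub>R w | s t. 0 \<le> s \<and> s \<le> 1 \<and> 0 \<le> t \<and> t \<le> 1})"

definition tiles_by_translation :: "(real^2) set \<Rightarrow> (real^2) set \<Rightarrow> bool" where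
  "tiles_by_translation P V \<longleftrightarrow>
     (\<Union>v\<in>V. (+) v ` P) = UNIV \<and>
     (\<forall>v\<in>V. \<forall>v'\<in>V. v \<noteq> v' \<longrightarrow> interior ((+) v ` P) \<inter> interior ((+) v' ` P) = {})"

text \<open>
  \<open>T'\<close> is the translate by \<open>w\<close> of the point reflection \<open>- T\<close>. The set \<open>V\<close> of translation
  vectors is not required to be a lattice.
\<close>

definition parallelogram_tiling :: "(real^2) set set \<Rightarrow> bool" where
  "parallelogram_tiling \<T> \<longleftrightarrow>
     triangulation \<T> \<and>
     (\<exists>T T' w V.
        triangle T \<and> T' = (+) w ` uminus ` T \<and>
        parallelogram (T \<union> T') \<and> tiles_by_translation (T \<union> T') V \<and>
        \<T> = (\<Union>v\<in>V. {(+) v ` T, (+) v ` T'}))"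

definition centered_square :: "real \<Rightarrow> (real^2) set" where
  "centered_square l = {x. \<bar>x$1\<bar> \<le> l / 2 \<and> \<bar>x$2\<bar> \<le> l / 2}"

definition triangle_density :: "(real^2) set set \<Rightarrow> ereal" where
  "triangle_density \<T> =
     Limsup at_top (\<lambda>l::real. ereal (real (card {S\<in>\<T>. S \<inter> centered_square l \<noteq> {}}) / l\<^sup>2))"


section \<open>Continuous piecewise linear approximations\<close>

definition affine_function_on :: "(real^2) set \<Rightarrow> (real^2 \<Rightarrow> real) \<Rightarrow> bool" where
  "affine_function_on S f \<longleftrightarrow> (\<exists>a b. \<forall>x\<in>S. f x = a \<bullet> x + b)"

definition continuous_pwl :: "(real^2) set set \<Rightarrow> (real^2 \<Rightarrow> real) \<Rightarrow> bool" where
  "continuous_pwl \<T> f \<longleftrightarrow> continuous_on UNIV f \<and> (\<forall>S\<in>\<T>. affine_function_on S f)"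

definition overestimation ::
    "real \<Rightarrow> (real^2 \<Rightarrow> real) \<Rightarrow> (real^2) set set \<Rightarrow> (real^2 \<Rightarrow> real) \<Rightarrow> bool" where
  "overestimation \<epsilon> F \<T> f \<longleftrightarrow>
     continuous_pwl \<T> f \<and> (\<forall>x. F x \<le> f x \<and> f x \<le> F x + \<epsilon>)"

definition underestimation ::
    "real \<Rightarrow> (real^2 \<Rightarrow> real) \<Rightarrow> (real^2) set set \<Rightarrow> (real^2 \<Rightarrow> real) \<Rightarrow> bool" where
  "underestimation \<epsilon> F \<T> f \<longleftrightarrow>
     continuous_pwl \<T> f \<and> (\<forall>x. F x - \<epsilon> \<le> f x \<and> f x \<le> F x)"

definition vertices :: "(real^2) set set \<Rightarrow> (real^2) set" where
  "vertices \<T> = {v. \<exists>S\<in>\<T>. v extreme_point_of S}"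

definition constant_deviation ::
    "(real^2 \<Rightarrow> real) \<Rightarrow> (real^2) set set \<Rightarrow> (real^2 \<Rightarrow> real) \<Rightarrow> real \<Rightarrow> bool" where
  "constant_deviation F \<T> f \<Delta> \<longleftrightarrow> (\<forall>v\<in>vertices \<T>. f v - F v = \<Delta>)"


section \<open>Optimality among parallelogram tilings\<close>

text \<open>
  The parameter \<open>E\<close> stands for \<^term>\<open>overestimation \<epsilon> F\<close> or \<^term>\<open>underestimation \<epsilon> F\<close>.
  The infimum is taken in the extended reals, so it would be \<open>\<infinity>\<close> if no tiling were admissible.
\<close>

definition optimal_density ::
    "((real^2) set set \<Rightarrow> (real^2 \<Rightarrow> real) \<Rightarrow> bool) \<Rightarrow> ereal" where
  "optimal_density E =
     (INF \<T>\<in>{\<T>. parallelogram_tiling \<T> \<and> (\<exists>f. E \<T> f)}. triangle_density \<T>)"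

definition optimal_tiling ::
    "((real^2) set set \<Rightarrow> (real^2 \<Rightarrow> real) \<Rightarrow> bool) \<Rightarrow> (real^2) set set \<Rightarrow> (real^2 \<Rightarrow> real) \<Rightarrow> bool" where
  "optimal_tiling E \<T> f \<longleftrightarrow>
     parallelogram_tiling \<T> \<and> E \<T> f \<and> triangle_density \<T> = optimal_density E"

text \<open>
  For \<open>F (x, y) = x * y\<close> the deviation of an optimal pair is not unique: if \<open>f\<close> is an
  overestimation, then so is \<open>(x, y) \<mapsto> \<epsilon> - f (- x, y)\<close> on the mirrored tiling, which has the same
  density. This exchanges the constant deviations \<open>2 * \<epsilon> / 3\<close> and \<open>\<epsilon> / 3\<close>, so statements about
  all optimal pairs have to allow both values. Underestimations behave in the same way.
\<close>

end

theory Submission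
  imports Defs
begin

text \<open>
  Along an edge \<open>x\<close> the deviation \<open>g = f - F\<close> at the midpoint is the mean of its end values plus
  \<open>F x / 4\<close>, so \<open>g v + g (v + x) + F x / 2\<close> lies in \<open>[0, 2 * \<epsilon>]\<close>. The vertices are
  invariant under translation by edges. If \<open>x + y + z = 0\<close> are the edges of a triangle, then comparing
  the conditions for two of them shows that \<open>g\<close> grows by at least \<open>(F x - F z) / 2 - 2 * \<epsilon>\<close> along
  the third; boundedness of \<open>g\<close> gives \<open>\<bar>F x - F z\<bar> \<le> 4 * \<epsilon>\<close>, and similarly
  \<open>\<bar>F x\<bar> \<le> 4 * \<epsilon>\<close>. With \<open>a, b, c\<close> the values of \<open>F\<close> at the edges, four times the squared area is
  \<open>a\<^sup>2 + b\<^sup>2 + c\<^sup>2 - 2 * a * b - 2 * b * c - 2 * c * a\<close>, whose maximum under these constraints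
  is \<open>64 / 3 * \<epsilon>\<^sup>2\<close>, attained only at \<open>(4, 4, - 8) * \<epsilon> / 3\<close> up to order and sign; there the edge
  conditions force \<open>g\<close> to be constant. The density is the reciprocal of the area. Adding \<open>\<epsilon>\<close> turns
  underestimations into overestimations.
\<close>

section \<open>Bounded functions along the edges of a triangle\<close>

text \<open>Here \<open>a\<close> stands for the value of \<open>F\<close> at \<open>x\<close>, and
  the sum is twice the deviation at the midpoint of the edge from \<open>w\<close> to
  \<open>w + x\<close>. In this form the extremal argument is free of geometry.\<close>

definition edge_bounds :: "('a::ab_group_add \<Rightarrow> real) \<Rightarrow> real \<Rightarrow> 'a set \<Rightarrow> 'a \<Rightarrow> real \<Rightarrow> bool" where
  "edge_bounds g e W x a \<longleftrightarrow>
     (\<forall>w\<in>W. w + x \<in> W \<and> w - x \<in> W \<and> 0 \<le> g w + g (w + x) + a / 2 \<and> g w + g (w + x) + a / 2 \<le> 2 * e)"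

lemma edge_boundsD:
  assumes "edge_bounds g e W x a" "w \<in> W"
  shows "w + x \<in> W" "w - x \<in> W" "0 \<le> g w + g (w + x) + a / 2" "g w + g (w + x) + a / 2 \<le> 2 * e"
    "0 \<le> g w + g (w - x) + a / 2" "g w + g (w - x) + a / 2 \<le> 2 * e"
proof -
  show 1: "w + x \<in> W" "w - x \<in> W" "0 \<le> g w + g (w + x) + a / 2" "g w + g (w + x) + a / 2 \<le> 2 * e"
    using assms by (auto simp: edge_bounds_def)
  have "0 \<le> g (w - x) + g (w - x + x) + a / 2" "g (w - x) + g (w - x + x) + a / 2 \<le> 2 * e"
    using assms(1) 1(2) by (auto simp only: edge_bounds_def)
  then show "0 \<le> g w + g (w - x) + a / 2" "g w + g (w - x) + a / 2 \<le> 2 * e"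
    by (simp_all add: add.commute)
qed

text \<open>The sum \<open>s\<close> of an edge becomes \<open>2 * e - s\<close>. This symmetry
  exchanges the two sign patterns of the extremal case.\<close>

lemma edge_bounds_reflect:
  assumes "edge_bounds g e W x a"
  shows "edge_bounds (\<lambda>w. e - g w) e W x (- a)"
  using edge_boundsD[OF assms] by (fastforce simp: edge_bounds_def)

text \<open>Steps of size \<open>d\<close> accumulate to \<open>n * d \<le> h n \<le> e\<close> for
  every \<open>n\<close>.\<close>

lemma bounded_no_drift:
  fixes h :: "nat \<Rightarrow> real"
  assumes step: "\<And>n. h n + d \<le> h (Suc n)" and bd: "\<And>n. 0 \<le> h n" "\<And>n. h n \<le> e"
  shows "d \<le> 0"
proof (rule ccontr)
  assume "\<not> d \<le> 0"
  then obtain n where n: "e < real n * d"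
    using reals_Archimedean3[of d] by auto
  have "real n * d \<le> h n" for n
  proof (induction n)
    case 0
    then show ?case using bd(1) by simp
  next
    case (Suc n)
    then show ?case using step[of n] by (simp add: algebra_simps)
  qed
  from this[of n] bd(2)[of n] n show False by simp
qed

lemma edge_bounds_diff:
  assumes eb: "edge_bounds g e W x a" "edge_bounds g e W y b" "edge_bounds g e W z c"
    and xyz: "x + y + z = 0" and p: "p \<in> W"
    and bd: "\<And>w. w \<in> W \<Longrightarrow> 0 \<le> g w" "\<And>w. w \<in> W \<Longrightarrow> g w \<le> e"
  shows "a - c \<le> 4 * e"
proof -
  have z: "z = - (x + y)"
    using xyz by (metis minus_unique minus_minus)
  have step: "w + y \<in> W \<and> g w + (a / 2 - c / 2 - 2 * e) \<le> g (w + y)" if w: "w \<in> W" for w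
  proof -
    \<comment> \<open>The detour from \<open>w\<close> over \<open>w - x\<close> to
      \<open>w + y\<close> runs along an edge \<open>x\<close> and an edge \<open>z\<close>, both
      backwards. The upper bound on the first keeps \<open>g (w - x)\<close> small; the lower bound
      on the second then makes \<open>g (w + y)\<close> large.\<close>
    have wx: "w - x \<in> W" using edge_boundsD(2)[OF eb(1) w] .
    have wz: "w - x - z = w + y"
      by (simp add: z algebra_simps)
    have "0 \<le> g (w - x) + g (w + y) + c / 2"
      using edge_boundsD(5)[OF eb(3) wx] unfolding wz .
    moreover have "g w + g (w - x) + a / 2 \<le> 2 * e"
      using edge_boundsD(6)[OF eb(1) w] .
    ultimately show ?thesis using edge_boundsD(1)[OF eb(2) w] by linarith
  qed
  \<comment> \<open>Walking along \<open>y\<close> forever stays in \<open>W\<close>, where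
    \<open>g\<close> is bounded, so the gain per step cannot be positive.\<close>
  define s where "s n = ((\<lambda>w. w + y) ^^ n) p" for n
  have s: "s n \<in> W" for n
    by (induction n) (auto simp: s_def p step)
  have "a / 2 - c / 2 - 2 * e \<le> 0"
  proof (rule bounded_no_drift)
    show "g (s n) + (a / 2 - c / 2 - 2 * e) \<le> g (s (Suc n))" for n
      using step[OF s[of n]] by (simp add: s_def)
  qed (use s bd in auto)
  then show ?thesis by simp
qed

text \<open>
  The sums of \<open>g\<close> over the edges \<open>x\<close> and \<open>y\<close> are at most \<open>4 * e / 3\<close>, those over \<open>z\<close> at least
  that; so \<open>g\<close> is monotone along \<open>x\<close> and cannot exceed \<open>2 * e / 3\<close>.
\<close>

lemma edge_bounds_extremal:
  assumes eb: "edge_bounds g e W x (4 * e / 3)" "edge_bounds g e W y (4 * e / 3)"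
    "edge_bounds g e W z (- (8 * e / 3))"
    and xyz: "x + y + z = 0" and w: "w \<in> W"
  shows "g w = 2 * e / 3"
proof -
  have z: "z = - (x + y)"
    using xyz by (metis minus_unique minus_minus)
  have le: "g w \<le> 2 * e / 3" if w: "w \<in> W" for w
  proof -
    have wy: "w - y \<in> W" using edge_boundsD(2)[OF eb(2) w] .
    have wz: "w - y - z = w + x"
      by (simp add: z algebra_simps)
    have "0 \<le> g (w - y) + g (w + x) - 4 * e / 3"
      using edge_boundsD(5)[OF eb(3) wy] unfolding wz by simp
    moreover have "g w + g (w - y) + 2 * e / 3 \<le> 2 * e"
      using edge_boundsD(6)[OF eb(2) w] by simp
    moreover have "g w + g (w + x) + 2 * e / 3 \<le> 2 * e"
      using edge_boundsD(4)[OF eb(1) w] by simp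
    ultimately show ?thesis by linarith
  qed
  \<comment> \<open>Both ends of the edge \<open>z\<close> are at most \<open>2 * e / 3\<close> and
    their sum is at least \<open>4 * e / 3\<close>, so both are equal to
    \<open>2 * e / 3\<close>.\<close>
  have "0 \<le> g w + g (w + z) - 4 * e / 3"
    using edge_boundsD(3)[OF eb(3) w] by simp
  then show ?thesis
    using le[OF w] le[OF edge_boundsD(1)[OF eb(3) w]] by linarith
qed

section \<open>Maximum of Heron's form under the edge constraints\<close>

text \<open>Heron's formula with values of a quadratic form in place of squared lengths; the sign is
  opposite to the Euclidean one because \<open>x * y\<close> is indefinite. It equals
  \<open>(c - a - b)\<^sup>2 - 4 * a * b\<close>.\<close>

definition heron :: "real \<Rightarrow> real \<Rightarrow> real \<Rightarrow> real" where
  "heron a b c = a\<^sup>2 + b\<^sup>2 + c\<^sup>2 - 2 * a * b - 2 * b * c - 2 * c * a"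

lemma heron_perm: "heron b a c = heron a b c" "heron a c b = heron a b c" "heron (-a) (-b) (-c) = heron a b c"
  by (simp_all add: heron_def algebra_simps)

text \<open>For \<open>a \<le> b \<le> c\<close> the products \<open>a * b\<close> and
  \<open>b * c\<close> absorb \<open>a\<^sup>2\<close> and \<open>b\<^sup>2\<close>, leaving at most
  \<open>c\<^sup>2\<close>; symmetry gives the other orders.\<close>

lemma heron_nonneg_le:
  assumes "0 \<le> a" "0 \<le> b" "0 \<le> c" "a \<le> M" "b \<le> M" "c \<le> M"
  shows "heron a b c \<le> M\<^sup>2"
proof -
  have *: "heron a b c \<le> M\<^sup>2" if "0 \<le> a" "a \<le> b" "b \<le> c" "c \<le> M" for a b c
  proof -
    have "a * a \<le> b * a" "c * c \<le> M * M" "b * b \<le> b * c" "0 \<le> b * c" "0 \<le> a * c" 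
      using that by (auto intro!: mult_mono mult_right_mono mult_left_mono)
    moreover have "0 \<le> a * b" using that by simp
    ultimately show ?thesis
      unfolding heron_def power2_eq_square by (simp add: algebra_simps)
  qed
  show ?thesis
    using *[of a b c] *[of a c b] *[of b a c] *[of b c a] *[of c a b] *[of c b a] assms
    by (simp add: heron_def algebra_simps) (smt (verit))
qed

text \<open>The form is convex in \<open>b\<close> between \<open>0\<close> and \<open>a\<close>,
  hence bounded by its values \<open>4 * C * a + C\<^sup>2\<close> at \<open>b = a\<close> or
  \<open>(a + C)\<^sup>2\<close> at \<open>b = 0\<close>; the case distinction decides which one is
  used. With \<open>a \<le> 4 * e - C\<close> the first is bounded by a parabola in \<open>C\<close>
  with peak at \<open>8 * e / 3\<close>; the second is at most \<open>16 * e\<^sup>2\<close>, which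
  is strictly below the maximum.\<close>

lemma heron_mixed:
  assumes "0 \<le> b" "b \<le> a" "0 \<le> C" "a + C \<le> 4 * e" "0 < e"
  shows "heron a b (- C) \<le> 64 / 3 * e\<^sup>2 \<and>
    (heron a b (- C) = 64 / 3 * e\<^sup>2 \<longrightarrow> a = 4 * e / 3 \<and> b = 4 * e / 3 \<and> C = 8 * e / 3)"
proof -
  have eq: "heron a b (- C) = (a - b)\<^sup>2 + 2 * C * (a + b) + C\<^sup>2"
    by (simp add: heron_def power2_eq_square algebra_simps)
  show ?thesis
  proof (cases "a - b \<le> 2 * C")
    case True
    have 1: "(a - b)\<^sup>2 \<le> (a - b) * (2 * C)"
      unfolding power2_eq_square using True assms by (intro mult_left_mono) auto
    have 2: "4 * C * a \<le> 4 * C * (4 * e - C)"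
      using assms by (intro mult_left_mono) auto
    have 3: "4 * C * (4 * e - C) + C\<^sup>2 = 64 / 3 * e\<^sup>2 - 3 * (C - 8 * e / 3)\<^sup>2"
      by (simp add: power2_eq_square algebra_simps)
    \<comment> \<open>One nonnegative slack is subtracted for each estimate, so equality in the
      final bound makes each of them vanish.\<close>
    have 4: "heron a b (- C) \<le> 64 / 3 * e\<^sup>2 - 3 * (C - 8 * e / 3)\<^sup>2
        - ((a - b) * (2 * C) - (a - b)\<^sup>2) - (4 * C * (4 * e - C) - 4 * C * a)"
      unfolding eq using 3 by (simp add: algebra_simps)
    have "a = 4 * e / 3 \<and> b = 4 * e / 3 \<and> C = 8 * e / 3" if "heron a b (- C) = 64 / 3 * e\<^sup>2"
    proof -
      have *: "0 \<le> (C - 8 * e / 3)\<^sup>2" by simp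
      have "(C - 8 * e / 3)\<^sup>2 = 0" using 1 2 4 that * by linarith
      then have C: "C = 8 * e / 3" by simp
      have "4 * C * (4 * e - C) = 4 * C * a" using 1 2 4 that * by linarith
      then have a: "a = 4 * e / 3" using C assms by simp
      have "(a - b) * (2 * C) = (a - b)\<^sup>2" using 1 2 4 that * by linarith
      \<comment> \<open>The second alternative would give \<open>b = - 4 * e\<close>, against
        \<open>0 \<le> b\<close>.\<close>
      then have "a - b = 0 \<or> 2 * C = a - b" by (simp add: power2_eq_square)
      then show ?thesis using a C assms by auto
    qed
    moreover have "heron a b (- C) \<le> 64 / 3 * e\<^sup>2"
    proof -
      have *: "0 \<le> (C - 8 * e / 3)\<^sup>2" by simp
      show ?thesis using 1 2 4 * by linarith
    qed
    ultimately show ?thesis by blast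
  next
    case False
    have "(a - b)\<^sup>2 + 2 * C * (a + b) = a\<^sup>2 + 2 * C * a + b * (b - 2 * a + 2 * C)"
      by (simp add: power2_eq_square algebra_simps)
    moreover have "b * (b - 2 * a + 2 * C) \<le> 0"
      using False assms by (intro mult_nonneg_nonpos) auto
    ultimately have "heron a b (- C) \<le> (a + C)\<^sup>2"
      unfolding eq by (simp add: power2_eq_square algebra_simps)
    also have "\<dots> \<le> (4 * e)\<^sup>2"
      using assms by (intro power_mono) auto
    also have "\<dots> = 16 * e\<^sup>2" by (simp add: power2_eq_square)
    finally have "heron a b (- C) \<le> 16 * e\<^sup>2" .
    moreover have "0 < e\<^sup>2" using assms by simp
    ultimately show ?thesis by linarith
  qed
qed

text \<open>The last argument is the value at the odd edge out; its other positions are covered by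
  rotating the arguments.\<close>

definition extremal :: "real \<Rightarrow> real \<Rightarrow> real \<Rightarrow> real \<Rightarrow> bool" where
  "extremal e a b c \<longleftrightarrow> a = 4 * e / 3 \<and> b = 4 * e / 3 \<and> c = - (8 * e / 3) \<or>
     a = - (4 * e / 3) \<and> b = - (4 * e / 3) \<and> c = 8 * e / 3"

text \<open>Two of the three numbers have the same sign, and the claim is symmetric under
  permutations and under a common change of sign, so \<open>a\<close> and \<open>b\<close> may be
  taken nonnegative. If \<open>c\<close> is nonnegative too, the form is at most
  \<open>16 * e\<^sup>2\<close>, strictly below the maximum; otherwise the mixed case applies with
  \<open>C = - c\<close>.\<close>

lemma heron_le:
  assumes e: "0 < e"
    and bd: "\<bar>a\<bar> \<le> 4 * e" "\<bar>b\<bar> \<le> 4 * e" "\<bar>c\<bar> \<le> 4 * e"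
    and df: "\<bar>a - b\<bar> \<le> 4 * e" "\<bar>b - c\<bar> \<le> 4 * e" "\<bar>a - c\<bar> \<le> 4 * e"
  shows "heron a b c \<le> 64 / 3 * e\<^sup>2 \<and>
    (heron a b c = 64 / 3 * e\<^sup>2 \<longrightarrow> extremal e a b c \<or> extremal e b c a \<or> extremal e c a b)"
    (is "?P a b c")
proof -
  have ext: "extremal e a b c \<longleftrightarrow> extremal e b a c" "extremal e (-a) (-b) (-c) \<longleftrightarrow> extremal e a b c" for a b c
    by (auto simp: extremal_def)
  have perm1: "?P a b c \<longleftrightarrow> ?P b a c" for a b c
    using heron_perm(1)[of b a c] ext(1) by metis
  have perm2: "?P a b c \<longleftrightarrow> ?P a c b" for a b c
    using heron_perm(2)[of a c b] ext(1) by metis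
  have perm3: "?P a b c \<longleftrightarrow> ?P (-a) (-b) (-c)" for a b c
    by (simp only: heron_perm(3) ext(2))
  note perm = perm1 perm2 perm3
  have same: "?P a b c" if "0 \<le> a" "0 \<le> b" "0 \<le> c" "a \<le> 4 * e" "b \<le> 4 * e" "c \<le> 4 * e" for a b c
  proof -
    have "heron a b c \<le> 16 * e\<^sup>2"
      using heron_nonneg_le[OF that] by (simp add: power2_eq_square)
    moreover have "0 < e\<^sup>2" using e by simp
    ultimately show ?thesis by linarith
  qed
  have mixed0: "?P a b c" if "c \<le> 0" "0 \<le> b" "b \<le> a" "a - c \<le> 4 * e" for a b c
    using heron_mixed[of b a "- c" e] that e by (auto simp: extremal_def)
  then have mixed: "?P a b c" if "c \<le> 0" "0 \<le> b" "0 \<le> a" "a - c \<le> 4 * e" "b - c \<le> 4 * e" for a b c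
    using mixed0[of c b a] mixed0[of c a b] that perm(1)[of a b c] by linarith
  have two: "?P a b c" if "0 \<le> a" "0 \<le> b" "\<bar>a\<bar> \<le> 4 * e" "\<bar>b\<bar> \<le> 4 * e" "\<bar>c\<bar> \<le> 4 * e"
     "\<bar>b - c\<bar> \<le> 4 * e" "\<bar>a - c\<bar> \<le> 4 * e" for a b c
  proof (cases "0 \<le> c")
    case True
    then show ?thesis using same[of a b c] that by simp
  next
    case False
    then show ?thesis using mixed[of c b a] that by simp
  qed
  have "(0 \<le> a \<and> 0 \<le> b) \<or> (0 \<le> a \<and> 0 \<le> c) \<or> (0 \<le> b \<and> 0 \<le> c) \<or> (0 \<le> -a \<and> 0 \<le> -b) \<or>
      (0 \<le> -a \<and> 0 \<le> -c) \<or> (0 \<le> -b \<and> 0 \<le> -c)"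
    by linarith
  then consider "0 \<le> a \<and> 0 \<le> b" | "0 \<le> a \<and> 0 \<le> c" | "0 \<le> b \<and> 0 \<le> c" | "0 \<le> -a \<and> 0 \<le> -b" |
      "0 \<le> -a \<and> 0 \<le> -c" | "0 \<le> -b \<and> 0 \<le> -c"
    by blast
  then show ?thesis
  proof cases
    case 1
    then show ?thesis using two[of a b c] bd df by simp
  next
    case 2
    then have "?P a c b" using two[of a c b] bd df by (simp add: abs_minus_commute)
    then show ?thesis using perm(2) by blast
  next
    case 3
    then have "?P b c a" using two[of b c a] bd df by (simp add: abs_minus_commute)
    then show ?thesis using perm by blast
  next
    case 4
    then have "?P (-a) (-b) (-c)" using two[of "-a" "-b" "-c"] bd df by (simp add: abs_minus_commute)
    then show ?thesis using perm(3) by blast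
  next
    case 5
    then have "?P (-a) (-c) (-b)" using two[of "-a" "-c" "-b"] bd df by (simp add: abs_minus_commute)
    then show ?thesis using perm by blast
  next
    case 6
    then have "?P (-b) (-c) (-a)" using two[of "-b" "-c" "-a"] bd df by (simp add: abs_minus_commute)
    then show ?thesis using perm by blast
  qed
qed

text \<open>The edges can be taken in any order, so the drift estimate bounds all differences of
  \<open>a\<close>, \<open>b\<close> and \<open>c\<close>; Heron's form then reaches its maximum
  only at values that force \<open>g\<close> to be constant.\<close>

lemma edge_bounds_heron:
  assumes eb: "edge_bounds g e W x a" "edge_bounds g e W y b" "edge_bounds g e W z c"
    and xyz: "x + y + z = 0" and p: "W \<noteq> {}" and e: "0 < e"
    and bd: "\<And>w. w \<in> W \<Longrightarrow> 0 \<le> g w" "\<And>w. w \<in> W \<Longrightarrow> g w \<le> e"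
  shows "heron a b c \<le> 64 / 3 * e\<^sup>2"
    and "heron a b c = 64 / 3 * e\<^sup>2 \<Longrightarrow> (\<forall>w\<in>W. g w = 2 * e / 3) \<or> (\<forall>w\<in>W. g w = e / 3)"
proof -
  obtain p where p: "p \<in> W" using p by blast
  have abs: "\<bar>a\<bar> \<le> 4 * e" if "edge_bounds g e W x a" for x a
  proof -
    \<comment> \<open>The two deviations contribute between \<open>0\<close> and
      \<open>2 * e\<close>, so \<open>a / 2\<close> lies between \<open>- 2 * e\<close> and
      \<open>2 * e\<close>.\<close>
    have "0 \<le> g p + g (p + x) + a / 2" "g p + g (p + x) + a / 2 \<le> 2 * e" "p + x \<in> W"
      using edge_boundsD[OF that p] by auto
    then show ?thesis using bd[OF p] bd[of "p + x"] by linarith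
  qed
  note diff = edge_bounds_diff[OF _ _ _ _ p bd]
  have df: "\<bar>a - b\<bar> \<le> 4 * e" "\<bar>b - c\<bar> \<le> 4 * e" "\<bar>a - c\<bar> \<le> 4 * e"
    using diff[OF eb(1,3,2)] diff[OF eb(2,3,1)] diff[OF eb(2,1,3)] diff[OF eb(3,1,2)]
      diff[OF eb(1,2,3)] diff[OF eb(3,2,1)] xyz
    by (simp_all add: algebra_simps abs_le_iff)
  note * = heron_le[OF e abs[OF eb(1)] abs[OF eb(2)] abs[OF eb(3)] df]
  then show "heron a b c \<le> 64 / 3 * e\<^sup>2" by blast
  have ext: "(\<forall>w\<in>W. g w = 2 * e / 3) \<or> (\<forall>w\<in>W. g w = e / 3)"
    if eb: "edge_bounds g e W x a" "edge_bounds g e W y b" "edge_bounds g e W z c"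
      and xyz: "x + y + z = 0" and ex: "extremal e a b c" for x y z a b c
    using ex unfolding extremal_def
  proof (elim disjE conjE)
    assume abc: "a = 4 * e / 3" "b = 4 * e / 3" "c = - (8 * e / 3)"
    have "g w = 2 * e / 3" if "w \<in> W" for w
      using edge_bounds_extremal[OF eb[unfolded abc] xyz that] .
    then show ?thesis by blast
  next
    \<comment> \<open>The opposite signs reduce to the first case for \<open>e - g\<close>, so the
      constant becomes \<open>e - 2 * e / 3\<close>.\<close>
    assume "a = - (4 * e / 3)" "b = - (4 * e / 3)" "c = 8 * e / 3"
    then have abc: "- a = 4 * e / 3" "- b = 4 * e / 3" "- c = - (8 * e / 3)" by auto
    have "e - g w = 2 * e / 3" if "w \<in> W" for w
      using edge_bounds_extremal[OF eb[THEN edge_bounds_reflect, unfolded abc] xyz that] .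
    then have "g w = e / 3" if "w \<in> W" for w
      using that by fastforce
    then show ?thesis by blast
  qed
  assume "heron a b c = 64 / 3 * e\<^sup>2"
  then consider "extremal e a b c" | "extremal e b c a" | "extremal e c a b" using * by blast
  then show "(\<forall>w\<in>W. g w = 2 * e / 3) \<or> (\<forall>w\<in>W. g w = e / 3)"
    using ext[OF eb] ext[OF eb(2,3,1)] ext[OF eb(3,1,2)] xyz by cases (simp_all add: algebra_simps)
qed

section \<open>Triangles in the plane\<close>

definition det2 :: "real^2 \<Rightarrow> real^2 \<Rightarrow> real" where
  "det2 u v = u$1 * v$2 - u$2 * v$1"

lemma vec2_eq_iff: "u = v \<longleftrightarrow> u$1 = v$1 \<and> u$2 = v$2" for u v :: "real^2"
  by (simp add: vec_eq_iff forall_2)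

lemma det2_zero_iff: "det2 u v = 0 \<longleftrightarrow> u = 0 \<or> (\<exists>k. v = k *\<^sub>R u)"
proof (cases "u = 0")
  case False
  show ?thesis
  proof
    assume d: "det2 u v = 0"
    from False have "u$1 \<noteq> 0 \<or> u$2 \<noteq> 0" by (simp add: vec2_eq_iff)
    then show "u = 0 \<or> (\<exists>k. v = k *\<^sub>R u)"
    proof
      assume "u$1 \<noteq> 0"
      then have "v = (v$1 / u$1) *\<^sub>R u" using d by (simp add: vec2_eq_iff det2_def field_simps)
      then show ?thesis by blast
    next
      assume "u$2 \<noteq> 0"
      then have "v = (v$2 / u$2) *\<^sub>R u" using d by (simp add: vec2_eq_iff det2_def field_simps)
      then show ?thesis by blast
    qed
  qed (auto simp: det2_def)
qed (simp add: det2_def)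

lemma affine_dependent_det2:
  assumes "distinct [p, q, r]"
  shows "affine_dependent {p, q, r} \<longleftrightarrow> det2 (q - p) (r - p) = 0"
proof -
  have "affine_dependent {p, q, r} \<longleftrightarrow> collinear {p, q, r}"
    using assms by (simp add: collinear_3_eq_affine_dependent)
  also have "\<dots> \<longleftrightarrow> collinear {q, p, r}"
    by (simp add: insert_commute)
  also have "\<dots> \<longleftrightarrow> collinear {0, q - p, r - p}"
    using collinear_3[of q p r] by simp
  also have "\<dots> \<longleftrightarrow> det2 (q - p) (r - p) = 0"
    unfolding collinear_lemma det2_zero_iff by auto
  finally show ?thesis .
qed

lemma det2_nonzero_distinct:
  assumes "det2 (q - p) (r - p) \<noteq> 0"
  shows "distinct [p, q, r]"
  using assms by (auto simp: det2_def)

lemma det2_affine_independent: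
  assumes "det2 (q - p) (r - p) \<noteq> 0"
  shows "\<not> affine_dependent {p, q, r}"
  using affine_dependent_det2[OF det2_nonzero_distinct[OF assms]] assms by simp

lemma triangle_iff:
  "triangle S \<longleftrightarrow> (\<exists>p q r. det2 (q - p) (r - p) \<noteq> 0 \<and> S = convex hull {p, q, r})"
proof
  assume "triangle S"
  then obtain C where C: "\<not> affine_dependent C" "card C = 3" "S = convex hull C"
    by (auto simp: simplex_def)
  then obtain p q r where "C = {p, q, r}" "distinct [p, q, r]"
    by (auto simp: card_3_iff)
  then show "\<exists>p q r. det2 (q - p) (r - p) \<noteq> 0 \<and> S = convex hull {p, q, r}"
    using C affine_dependent_det2 by blast
next
  assume "\<exists>p q r. det2 (q - p) (r - p) \<noteq> 0 \<and> S = convex hull {p, q, r}"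
  then obtain p q r where *: "det2 (q - p) (r - p) \<noteq> 0" "S = convex hull {p, q, r}" by blast
  have "card {p, q, r} = 3" using det2_nonzero_distinct[OF *(1)] by simp
  then show "triangle S"
    unfolding simplex_def using det2_affine_independent[OF *(1)] * by (intro exI[of _ "{p, q, r}"]) auto
qed

lemma extreme_point_of_triangle:
  assumes "det2 (q - p) (r - p) \<noteq> 0"
  shows "v extreme_point_of (convex hull {p, q, r}) \<longleftrightarrow> v \<in> {p, q, r}"
  by (rule extreme_point_of_convex_hull_affine_independent[OF det2_affine_independent[OF assms]])

lemma triangle_vertices_unique:
  assumes "det2 (q - p) (r - p) \<noteq> 0" "det2 (q' - p') (r' - p') \<noteq> 0"
    and "convex hull {p, q, r} = convex hull {p', q', r'}"
  shows "{p, q, r} = {p', q', r'}"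
  using extreme_point_of_triangle[OF assms(1)] extreme_point_of_triangle[OF assms(2)]
  by (intro set_eqI) (simp only: assms(3))

section \<open>The neighbour of a triangle across an edge\<close>

text \<open>A face that contains an inner point of a segment contains both ends, and every face of a
  simplex is spanned by some of its vertices; being proper, this one omits \<open>r\<close>.\<close>

lemma proper_face_of_triangle_edge:
  assumes d: "det2 (q - p) (r - p) \<noteq> 0"
    and F: "F face_of (convex hull {p, q, r})" "F \<noteq> convex hull {p, q, r}" "midpoint p q \<in> F"
  shows "F = convex hull {p, q}"
proof -
  let ?S = "convex hull {p, q, r}"
  have "p \<noteq> q" using d by (auto simp: det2_def)
  then have "midpoint p q \<in> open_segment p q" by simp
  moreover have "p \<in> ?S" "q \<in> ?S" by (simp_all add: hull_inc)
  ultimately have pq: "p \<in> F" "q \<in> F"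
    using F(1,3) unfolding face_of_def by blast+
  obtain c where c: "c \<subseteq> {p, q, r}" "F = convex hull c"
    using F(1) face_of_convex_hull_affine_independent[OF det2_affine_independent[OF d]] by auto
  have "v \<in> c" if "v \<in> {p, q, r}" "v \<in> F" for v
  proof -
    have "v extreme_point_of ?S" using extreme_point_of_triangle[OF d] that(1) by blast
    then have "v extreme_point_of F"
      using extreme_point_of_face[OF F(1)] that(2) by blast
    then show ?thesis using c(2) extreme_point_of_convex_hull by blast
  qed
  then have "p \<in> c" "q \<in> c" using pq by auto
  moreover have "r \<notin> c"
  proof
    assume "r \<in> c"
    then have "c = {p, q, r}" using calculation c(1) by blast
    then show False using c(2) F(2) by simp
  qed
  ultimately have "c = {p, q}" using c(1) by blast
  then show ?thesis using c(2) by simp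
qed

text \<open>The barycentric coordinate of this point at \<open>r\<close> is \<open>- t\<close>.
  Membership would make a positive multiple of \<open>r - p\<close> parallel to
  \<open>q - p\<close>.\<close>

lemma midpoint_beyond_edge:
  assumes d: "det2 (q - p) (r - p) \<noteq> 0" and t: "t > 0"
  shows "midpoint p q + t *\<^sub>R (midpoint p q - r) \<notin> convex hull {p, q, r}"
proof
  assume "midpoint p q + t *\<^sub>R (midpoint p q - r) \<in> convex hull {p, q, r}"
  then obtain u v w where uvw: "0 \<le> u" "0 \<le> v" "0 \<le> w" "u + v + w = 1"
    and eq: "midpoint p q + t *\<^sub>R (midpoint p q - r) = u *\<^sub>R p + v *\<^sub>R q + w *\<^sub>R r"
    by (auto simp: convex_hull_3)
  define X where "X = q - p"
  define Y where "Y = r - p"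
  have qr: "q = p + X" "r = p + Y" by (simp_all add: X_def Y_def)
  have u: "u = 1 - v - w" using uvw by simp
  have "(w + t) *\<^sub>R Y = ((1 + t) / 2 - v) *\<^sub>R X"
    using eq unfolding qr midpoint_def u by (simp add: vec2_eq_iff field_simps)
  then have "det2 X ((w + t) *\<^sub>R Y) = 0"
    by (simp add: det2_def)
  then have "(w + t) * det2 X Y = 0"
    by (simp add: det2_def algebra_simps)
  then show False using d uvw t by (simp add: X_def Y_def)
qed

lemma mem_closed_if_frequently:
  fixes m u :: "'a::real_normed_vector"
  assumes "closed S" "infinite {n. m + inverse (real (Suc n)) *\<^sub>R u \<in> S}"
  shows "m \<in> S"
proof -
  obtain f :: "nat \<Rightarrow> nat" where f: "strict_mono f"
    "\<forall>n. f n \<in> {n. m + inverse (real (Suc n)) *\<^sub>R u \<in> S}"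
    using infinite_enumerate[OF assms(2)] by blast
  from f(2) have S: "m + inverse (real (Suc (f n))) *\<^sub>R u \<in> S" for n by blast
  have "(\<lambda>n. m + inverse (real (Suc n)) *\<^sub>R u) \<longlonglongrightarrow> m + 0 *\<^sub>R u"
    by (intro tendsto_intros LIMSEQ_inverse_real_of_nat)
  then have "(\<lambda>n. m + inverse (real (Suc (f n))) *\<^sub>R u) \<longlonglongrightarrow> m"
    by (auto dest: LIMSEQ_subseq_LIMSEQ[OF _ f(1)] simp: o_def)
  then show ?thesis using closed_sequentially[OF assms(1), of "\<lambda>n. m + inverse (real (Suc (f n))) *\<^sub>R u"] S by blast
qed

text \<open>A sequence approaches the midpoint of \<open>p\<close> and \<open>q\<close> from the
  side away from \<open>r\<close>. By local finiteness some triangle contains infinitely many of its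
  points and, being closed, the midpoint. It is not the given triangle, so the two meet in a proper
  face through the midpoint, which is the edge.\<close>

lemma triangulation_neighbour:
  assumes T: "triangulation \<T>" and S: "convex hull {p, q, r} \<in> \<T>"
    and d: "det2 (q - p) (r - p) \<noteq> 0"
  obtains r' where "convex hull {p, q, r'} \<in> \<T>" "det2 (q - p) (r' - p) \<noteq> 0"
    "convex hull {p, q, r'} \<noteq> convex hull {p, q, r}"
proof -
  let ?S = "convex hull {p, q, r}"
  define m where "m = midpoint p q"
  define x where "x n = m + inverse (real (Suc n)) *\<^sub>R (m - r)" for n
  have "locally_finite_in euclidean \<T>"
    using T by (simp add: triangulation_def)
  then obtain V where V: "open V" "m \<in> V" "finite {U \<in> \<T>. U \<inter> V \<noteq> {}}"
    unfolding locally_finite_in_def by auto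
  have "x \<longlonglongrightarrow> m + 0 *\<^sub>R (m - r)"
    unfolding x_def by (intro tendsto_intros LIMSEQ_inverse_real_of_nat)
  then have "\<forall>\<^sub>F n in sequentially. x n \<in> V"
    using topological_tendstoD[OF _ V(1)] V(2) by simp
  then obtain N where N: "\<And>n. n \<ge> N \<Longrightarrow> x n \<in> V"
    by (auto simp: eventually_sequentially)
  have "\<exists>U. U \<in> \<T> \<and> x n \<in> U" for n
    using T by (auto simp: triangulation_def)
  then obtain U where U: "\<And>n. U n \<in> \<T>" "\<And>n. x n \<in> U n" by metis
  have "U ` {N..} \<subseteq> {U \<in> \<T>. U \<inter> V \<noteq> {}}"
    using U N by auto
  then have "finite (U ` {N..})" using V(3) finite_subset by blast
  then obtain S' where S': "S' \<in> U ` {N..}" "infinite (U -` {S'} \<inter> {N..})"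
    using pigeonhole_infinite[of "{N..}" U] infinite_Ici by (auto simp: vimage_def Int_def conj_commute)
  have S'T: "S' \<in> \<T>" using S' U by auto
  have tri: "triangle S'" using T S'T by (auto simp: triangulation_def)
  have "U -` {S'} \<inter> {N..} \<subseteq> {n. x n \<in> S'}" using U by auto
  then have "infinite {n. x n \<in> S'}" using S'(2) finite_subset by blast
  then have mS': "m \<in> S'"
    using mem_closed_if_frequently[of S' m "m - r"] closed_simplex[OF tri] by (simp add: x_def)
  obtain k where k: "x k \<in> S'" using S' U by auto
  have "x k \<notin> ?S"
    unfolding x_def m_def by (rule midpoint_beyond_edge[OF d]) simp
  then have ne: "S' \<noteq> ?S" using k by blast
  have "m \<in> closed_segment p q" by (simp add: m_def)
  also have "closed_segment p q \<subseteq> ?S"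
    by (simp add: segment_convex_hull hull_mono)
  finally have mS: "m \<in> ?S" .
  then have "?S \<inter> S' \<noteq> {}" using mS' by blast
  then have f: "(?S \<inter> S') face_of ?S" "(?S \<inter> S') face_of S'" "?S \<inter> S' \<noteq> ?S" "?S \<inter> S' \<noteq> S'"
    using T S S'T ne unfolding triangulation_def by metis+
  have I: "?S \<inter> S' = convex hull {p, q}"
    by (rule proper_face_of_triangle_edge[OF d f(1,3)]) (use mS mS' in \<open>auto simp: m_def\<close>)
  \<comment> \<open>The common edge is also a face of \<open>S'\<close>, hence spanned by vertices
    of \<open>S'\<close>; comparing extreme points shows that \<open>p\<close> and \<open>q\<close>
    are among them.\<close>
  obtain C where C: "\<not> affine_dependent C" "card C = 3" "S' = convex hull C"
    using tri by (auto simp: simplex_def)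
  obtain c where c: "c \<subseteq> C" "convex hull {p, q} = convex hull c"
    using f(2) face_of_convex_hull_affine_independent[OF C(1)] C(3) I by auto
  have "\<not> affine_dependent c" using C(1) c(1) affine_independent_subset by blast
  then have ec: "v extreme_point_of (convex hull c) \<longleftrightarrow> v \<in> c" for v
    by (rule extreme_point_of_convex_hull_affine_independent)
  have epq: "v extreme_point_of (convex hull {p, q}) \<longleftrightarrow> v \<in> {p, q}" for v
    by (rule extreme_point_of_convex_hull_affine_independent) simp
  have "p \<in> c" "q \<in> c" using ec[of p] ec[of q] epq[of p] epq[of q] c(2) by simp_all
  then have "{p, q} \<subseteq> C" using c(1) by blast
  have pq: "p \<noteq> q" using d by (auto simp: det2_def)
  have "card (C - {p, q}) = 1"
    using \<open>{p, q} \<subseteq> C\<close> C(2) pq by (subst card_Diff_subset) auto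
  then obtain r' where r': "C - {p, q} = {r'}" by (auto simp: card_1_singleton_iff)
  then have CC: "C = {p, q, r'}" "distinct [p, q, r']" using \<open>{p, q} \<subseteq> C\<close> pq by auto
  show ?thesis
  proof (rule that)
    show "convex hull {p, q, r'} \<in> \<T>" using S'T C CC by simp
    show "det2 (q - p) (r' - p) \<noteq> 0" using affine_dependent_det2[OF CC(2)] C CC by simp
    show "convex hull {p, q, r'} \<noteq> ?S" using ne C CC by simp
  qed
qed

section \<open>Triangulations by translates of a triangle and its reflection\<close>

lemma triangle_translate:
  "(+) d ` (convex hull {p, q, r}) = convex hull {d + p, d + q, d + r}"
  using convex_hull_translation[of d "{p, q, r}"] by simp

lemma triangle_uminus:
  fixes p q r :: "'a::euclidean_space"
  shows "uminus ` (convex hull {p, q, r}) = convex hull {- p, - q, - r}"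
  using convex_hull_linear_image[of uminus "{p, q, r}"] by (simp add: linear_uminus)

lemma measure_lebesgue_triangle:
  "measure lebesgue (convex hull {p, q, r}) = \<bar>det2 (q - p) (r - p)\<bar> / 2"
proof -
  have "measure lebesgue (convex hull {p, q, r}) = measure lborel (convex hull {p, q, r})"
    by (intro measure_completion) (simp add: compact_imp_closed finite_imp_compact_convex_hull)
  then show ?thesis
    unfolding content_triangle by (simp add: det2_def abs_minus_commute algebra_simps)
qed

text \<open>
  The edges of a triangle are pairwise non-parallel, so a translate sharing an edge with it is the
  triangle itself, and a translate of its point reflection sharing an edge is the reflection in the
  midpoint of that edge.
\<close>

lemma translate_sharing_edge:
  assumes d: "det2 (q - p) (r - p) \<noteq> 0" "det2 (q - p) (r' - p) \<noteq> 0"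
    and eq: "convex hull {p, q, r'} = (+) d ` (convex hull {p, q, r})"
  shows "d = 0"
proof -
  have "det2 ((d + q) - (d + p)) ((d + r) - (d + p)) \<noteq> 0" using d(1) by simp
  then have "{p, q, r'} = {d + p, d + q, d + r}"
    using triangle_vertices_unique[OF d(2)] eq unfolding triangle_translate by blast
  then have m: "p \<in> {d + p, d + q, d + r}" "q \<in> {d + p, d + q, d + r}" by blast+
  have col: False if "q = p + s *\<^sub>R u" "r = p + t *\<^sub>R u" for u s t
    using d(1) by (simp add: that det2_def)
  have pq: "p \<noteq> q" using d(1) by (auto simp: det2_def)
  show ?thesis
  proof (rule ccontr)
    assume "d \<noteq> 0"
    \<comment> \<open>The first case gives \<open>2 *\<^sub>R d = 0\<close>; the other two put
      \<open>p\<close>, \<open>q\<close> and \<open>r\<close> on a line in direction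
      \<open>d\<close>.\<close>
    then consider "p = d + q" "q = d + p" | "p = d + q" "q = d + r" | "p = d + r" "q = d + p"
      using m pq by auto
    then show False
    proof cases
      case 1
      then have "2 *\<^sub>R d = 0" by (simp add: vec2_eq_iff)
      then show False using \<open>d \<noteq> 0\<close> by simp
    next
      case 2
      have "q = p + (-1) *\<^sub>R d" using 2(1) by simp
      moreover have "r = p + (-2) *\<^sub>R d" unfolding 2(1) by (subst 2(2)) (simp add: vec2_eq_iff)
      ultimately show False by (rule col)
    next
      case 3
      have "q = p + 1 *\<^sub>R d" using 3(2) by simp
      moreover have "r = p + (-1) *\<^sub>R d" using 3(1) by simp
      ultimately show False by (rule col)
    qed
  qed
qed

lemma reflection_sharing_edge:
  assumes d: "det2 (q - p) (r - p) \<noteq> 0" "det2 (q - p) (r' - p) \<noteq> 0"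
    and eq: "convex hull {p, q, r'} = (+) d ` uminus ` (convex hull {p, q, r})"
  shows "r' = p + q - r"
proof -
  have "det2 ((d - q) - (d - p)) ((d - r) - (d - p)) \<noteq> 0" using d(1) unfolding det2_def by (simp add: algebra_simps)
  then have vs: "{p, q, r'} = {d - p, d - q, d - r}"
    using triangle_vertices_unique[OF d(2)] eq unfolding triangle_translate triangle_uminus by simp
  then have m: "p \<in> {d - p, d - q, d - r}" "q \<in> {d - p, d - q, d - r}" by blast+
  have col: False if "r = p + t *\<^sub>R (q - p)" for t
    using d(1) by (simp add: that det2_def)
  have pq: "p \<noteq> q" "r' \<noteq> p" "r' \<noteq> q" using d by (auto simp: det2_def)
  have *: "r' = p + q - r" if "d = p + q"
  proof -
    have "r' \<in> {d - p, d - q, d - r}" using vs by blast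
    then show ?thesis using that pq by auto
  qed
  \<comment> \<open>The value \<open>d = p + q\<close> is the reflection in the midpoint of the
    edge. The other cases give \<open>p = q\<close> or put \<open>r\<close> on the line through
    \<open>p\<close> and \<open>q\<close>.\<close>
  consider "d = p + q" | "p = d - p" "q = d - q" | "p = d - p" "q = d - r" | "p = d - r" "q = d - q"
    | "p = d - r" "q = d - r"
    using m by (auto simp: algebra_simps)
  then show ?thesis
  proof cases
    case 2
    then have "p = q" by (simp add: vec2_eq_iff)
    then show ?thesis using pq by simp
  next
    case 3
    then show ?thesis using col[of "-1"] by (simp add: vec2_eq_iff)
  next
    case 4
    then show ?thesis using col[of 2] by (simp add: vec2_eq_iff)
  qed (use * pq in auto)
qed

section \<open>Invariance of the vertices under translation by edges\<close>

text \<open>The vectors \<open>d\<close> are arbitrary; periodicity of the vertices is deduced by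
  passing from a triangle to its neighbours.\<close>

locale congruent_triangulation =
  fixes \<T> :: "(real^2) set set" and a b c :: "real^2"
  assumes tri: "triangulation \<T>"
    and nondeg: "det2 (b - a) (c - a) \<noteq> 0"
    and copy: "S \<in> \<T> \<Longrightarrow> \<exists>d. S = (+) d ` (convex hull {a, b, c}) \<or> S = (+) d ` uminus ` (convex hull {a, b, c})"
begin

lemma copy_of_copy:
  assumes "S \<in> \<T>" "S' \<in> \<T>"
  shows "\<exists>d. S' = (+) d ` S \<or> S' = (+) d ` uminus ` S"
proof -
  let ?T = "convex hull {a, b, c}"
  obtain d where d: "S = (+) d ` ?T \<or> S = (+) d ` uminus ` ?T" using copy[OF assms(1)] by blast
  obtain d' where d': "S' = (+) d' ` ?T \<or> S' = (+) d' ` uminus ` ?T" using copy[OF assms(2)] by blast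
  from d d' show ?thesis
  proof (elim disjE)
    assume "S = (+) d ` ?T" "S' = (+) d' ` ?T"
    then show ?thesis by (intro exI[of _ "d' - d"]) (simp add: image_image)
  next
    assume "S = (+) d ` uminus ` ?T" "S' = (+) d' ` uminus ` ?T"
    then show ?thesis by (intro exI[of _ "d' - d"]) (simp add: image_image)
  next
    assume "S = (+) d ` ?T" "S' = (+) d' ` uminus ` ?T"
    then show ?thesis by (intro exI[of _ "d' + d"]) (simp add: image_image)
  next
    assume "S = (+) d ` uminus ` ?T" "S' = (+) d' ` ?T"
    then show ?thesis by (intro exI[of _ "d' + d"]) (simp add: image_image)
  qed
qed

text \<open>The neighbour across the edge is a copy of the triangle. A translate sharing the edge
  would be the triangle itself, so the neighbour is the reflection in the midpoint.\<close>

lemma reflect_edge: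
  assumes S: "convex hull {p, q, r} \<in> \<T>" and d: "det2 (q - p) (r - p) \<noteq> 0"
  shows "convex hull {p, q, p + q - r} \<in> \<T>"
proof -
  obtain r' where r': "convex hull {p, q, r'} \<in> \<T>" "det2 (q - p) (r' - p) \<noteq> 0"
    "convex hull {p, q, r'} \<noteq> convex hull {p, q, r}"
    using triangulation_neighbour[OF tri S d] by metis
  obtain d' where "convex hull {p, q, r'} = (+) d' ` (convex hull {p, q, r}) \<or>
     convex hull {p, q, r'} = (+) d' ` uminus ` (convex hull {p, q, r})"
    using copy_of_copy[OF S r'(1)] by blast
  then have "r' = p + q - r"
  proof
    assume *: "convex hull {p, q, r'} = (+) d' ` (convex hull {p, q, r})"
    then have "d' = 0" using translate_sharing_edge[OF d r'(2)] by blast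
    then show ?thesis using * r'(3) by simp
  qed (rule reflection_sharing_edge[OF d r'(2)])
  then show ?thesis using r'(1) by simp
qed

text \<open>Two point reflections compose to a translation: the first is in the midpoint of
  \<open>p\<close> and \<open>q\<close>, the second in the midpoint of the edge from
  \<open>q\<close> to \<open>p + q - r\<close> of the reflected triangle.\<close>

lemma translate_edge:
  assumes S: "convex hull {p, q, r} \<in> \<T>" and d: "det2 (q - p) (r - p) \<noteq> 0"
  shows "(+) (q - r) ` (convex hull {p, q, r}) \<in> \<T>"
proof -
  have "convex hull {q, p + q - r, p} \<in> \<T>"
    using reflect_edge[OF S d] by (simp add: insert_commute)
  moreover have "det2 (p + q - r - q) (p - q) \<noteq> 0"
    using d by (simp add: det2_def algebra_simps)
  ultimately have "convex hull {q, p + q - r, q + (p + q - r) - p} \<in> \<T>"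
    by (rule reflect_edge)
  moreover have "{q, p + q - r, q + (p + q - r) - p} = {q - r + p, q - r + q, q - r + r}"
    by (auto simp: algebra_simps)
  ultimately show ?thesis unfolding triangle_translate by simp
qed

lemma translate_edges:
  assumes S: "convex hull {p, q, r} \<in> \<T>" and d: "det2 (q - p) (r - p) \<noteq> 0"
    and u: "u \<in> {p, q, r}" "v \<in> {p, q, r}"
  shows "(+) (u - v) ` (convex hull {p, q, r}) \<in> \<T>"
proof -
  have 0: "(+) 0 ` (convex hull {p, q, r}) \<in> \<T>" using S by simp
  have perm: "convex hull {p, r, q} = convex hull {p, q, r}" "convex hull {q, p, r} = convex hull {p, q, r}"
    "convex hull {q, r, p} = convex hull {p, q, r}" "convex hull {r, p, q} = convex hull {p, q, r}"
    "convex hull {r, q, p} = convex hull {p, q, r}"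
    by (simp_all add: insert_commute)
  have ds: "det2 (r - p) (q - p) \<noteq> 0" "det2 (p - q) (r - q) \<noteq> 0" "det2 (r - q) (p - q) \<noteq> 0"
    "det2 (p - r) (q - r) \<noteq> 0" "det2 (q - r) (p - r) \<noteq> 0"
    using d unfolding det2_def by (simp_all add: algebra_simps)
  note t = translate_edge[of p r q, unfolded perm, OF S ds(1)] translate_edge[of q p r, unfolded perm, OF S ds(2)]
    translate_edge[of q r p, unfolded perm, OF S ds(3)] translate_edge[of r p q, unfolded perm, OF S ds(4)]
    translate_edge[of r q p, unfolded perm, OF S ds(5)] translate_edge[OF S d]
  from u have "u - v \<in> {0, q - r, r - q, p - r, r - p, p - q, q - p}" by auto
  then show ?thesis using t 0 by (elim insertE) simp_all
qed

lemma triangle_form: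
  assumes "S \<in> \<T>"
  obtains d where "S = convex hull {d + a, d + b, d + c}" | d where "S = convex hull {d - a, d - b, d - c}"
proof -
  obtain d where "S = (+) d ` (convex hull {a, b, c}) \<or> S = (+) d ` uminus ` (convex hull {a, b, c})"
    using copy[OF assms] by blast
  then have "S = convex hull {d + a, d + b, d + c} \<or> S = convex hull {d - a, d - b, d - c}"
    by (simp add: triangle_translate triangle_uminus)
  then show thesis using that by blast
qed

lemma nondeg_translate:
  "det2 ((d + b) - (d + a)) ((d + c) - (d + a)) \<noteq> 0"
  "det2 ((d - b) - (d - a)) ((d - c) - (d - a)) \<noteq> 0"
  using nondeg unfolding det2_def by (simp_all add: algebra_simps)

lemma measure_triangle:
  assumes "S \<in> \<T>"
  shows "measure lebesgue S = \<bar>det2 (b - a) (c - a)\<bar> / 2"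
  by (rule triangle_form[OF assms]) (simp_all add: measure_lebesgue_triangle det2_def abs_minus_commute algebra_simps)

text \<open>A triangle with corner \<open>v\<close> is translated along one of its edges until the
  suitable corner lies at \<open>v\<close>; another corner then lies at
  \<open>v + (u1 - u2)\<close>.\<close>

lemma vertex_edge:
  assumes v: "v \<in> vertices \<T>" and u: "u1 \<in> {a, b, c}" "u2 \<in> {a, b, c}"
  shows "v + (u1 - u2) \<in> vertices \<T> \<and> (\<exists>S\<in>\<T>. v \<in> S \<and> v + (u1 - u2) \<in> S)"
proof -
  have *: "v \<in> vertices \<T> \<and> w \<in> vertices \<T> \<and> (\<exists>S\<in>\<T>. v \<in> S \<and> w \<in> S)"
    if S: "convex hull {p, q, r} \<in> \<T>" and d: "det2 (q - p) (r - p) \<noteq> 0"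
      and u: "v - t \<in> {p, q, r}" "w - t \<in> {p, q, r}" and t: "t = x - y" "x \<in> {p, q, r}" "y \<in> {p, q, r}"
    for p q r t x y v w
  proof -
    let ?S = "convex hull {t + p, t + q, t + r}"
    have S': "?S \<in> \<T>"
      using translate_edges[OF S d t(2,3)] unfolding triangle_translate t(1) .
    have vw: "v \<in> {t + p, t + q, t + r}" "w \<in> {t + p, t + q, t + r}"
      using u by (simp_all add: diff_eq_eq add.commute)
    have "det2 ((t + q) - (t + p)) ((t + r) - (t + p)) \<noteq> 0" using d by simp
    note ex = extreme_point_of_triangle[OF this]
    have "v extreme_point_of ?S" "w extreme_point_of ?S" using vw ex by simp_all
    moreover from this have "v \<in> ?S" "w \<in> ?S" by (simp_all only: extreme_point_of_def)
    ultimately show ?thesis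
      using S' unfolding vertices_def by blast
  qed
  obtain S where S: "S \<in> \<T>" "v extreme_point_of S" using v by (auto simp: vertices_def)
  from S(1) show ?thesis
  proof (cases rule: triangle_form)
    case (1 d)
    have "v \<in> {d + a, d + b, d + c}"
      using S(2) extreme_point_of_triangle[OF nondeg_translate(1)] unfolding 1 by blast
    then obtain u3 where u3: "u3 \<in> {a, b, c}" "v = d + u3" by auto
    have m: "d + u \<in> {d + a, d + b, d + c}" if "u \<in> {a, b, c}" for u
      using that by (elim insertE emptyE) simp_all
    have "v - (u3 - u2) = d + u2" "v + (u1 - u2) - (u3 - u2) = d + u1" "u3 - u2 = (d + u3) - (d + u2)"
      using u3(2) by (simp_all add: algebra_simps)
    then show ?thesis
      using *[OF S(1)[unfolded 1] nondeg_translate(1), of v "u3 - u2" "v + (u1 - u2)" "d + u3" "d + u2"]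
        m[OF u(1)] m[OF u(2)] m[OF u3(1)] by metis
  next
    case (2 d)
    have "v \<in> {d - a, d - b, d - c}"
      using S(2) extreme_point_of_triangle[OF nondeg_translate(2)] unfolding 2 by blast
    then obtain u3 where u3: "u3 \<in> {a, b, c}" "v = d - u3" by auto
    have m: "d - u \<in> {d - a, d - b, d - c}" if "u \<in> {a, b, c}" for u
      using that by (elim insertE emptyE) simp_all
    \<comment> \<open>In a reflected triangle the edges run backwards: the translation by
      \<open>u1 - u3\<close> brings \<open>d - u1\<close> to \<open>v\<close> and
      \<open>d - u2\<close> to \<open>v + (u1 - u2)\<close>.\<close>
    have "v - (u1 - u3) = d - u1" "v + (u1 - u2) - (u1 - u3) = d - u2" "u1 - u3 = (d - u3) - (d - u1)"
      using u3(2) by (simp_all add: algebra_simps)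
    then show ?thesis
      using *[OF S(1)[unfolded 2] nondeg_translate(2), of v "u1 - u3" "v + (u1 - u2)" "d - u3" "d - u1"]
        m[OF u(1)] m[OF u(2)] m[OF u3(1)] by metis
  qed
qed

section \<open>Area bound for overestimations\<close>

text \<open>Both ends of an edge lie in one triangle, on which \<open>f\<close> is affine, so the
  bounds on \<open>f\<close> at the midpoint become bounds on the deviations at the ends.\<close>

lemma overestimation_edge_bounds:
  assumes F: "F = (\<lambda>x. x$1 * x$2)" and f: "overestimation e F \<T> f"
    and u: "u1 \<in> {a, b, c}" "u2 \<in> {a, b, c}"
  shows "edge_bounds (\<lambda>x. f x - F x) e (vertices \<T>) (u1 - u2) (F (u1 - u2))"
  unfolding edge_bounds_def
proof
  fix w assume w: "w \<in> vertices \<T>"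
  let ?x = "u1 - u2" and ?g = "\<lambda>x. f x - F x"
  obtain S where S: "S \<in> \<T>" "w \<in> S" "w + ?x \<in> S" "w + ?x \<in> vertices \<T>"
    using vertex_edge[OF w u] by blast
  have "w - ?x = w + (u2 - u1)" by simp
  then have minus: "w - ?x \<in> vertices \<T>"
    using vertex_edge[OF w u(2) u(1)] by metis
  have "convex S" using S(1) tri by (auto simp: triangulation_def intro: convex_simplex)
  then have "(1 / 2) *\<^sub>R w + (1 / 2) *\<^sub>R (w + ?x) \<in> S"
    using S by (intro convexD) auto
  moreover have m: "(1 / 2) *\<^sub>R w + (1 / 2) *\<^sub>R (w + ?x) = w + (1 / 2) *\<^sub>R ?x"
    by (simp add: vec2_eq_iff field_simps)
  ultimately have mS: "w + (1 / 2) *\<^sub>R ?x \<in> S" by metis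
  obtain k l where "\<And>y. y \<in> S \<Longrightarrow> f y = k \<bullet> y + l"
    using f S(1) unfolding overestimation_def continuous_pwl_def affine_function_on_def by metis
  note fv = this[OF S(2)] this[OF S(3)] this[OF mS]
  have "f (w + (1 / 2) *\<^sub>R ?x) = (f w + f (w + ?x)) / 2"
    unfolding fv by (simp only: inner_add_right inner_scaleR_right) argo
  \<comment> \<open>Since \<open>F\<close> is a quadratic form, its value at a midpoint falls short
    of the mean of the end values by a quarter of its value at the edge.\<close>
  moreover have "F (w + (1 / 2) *\<^sub>R ?x) = (F w + F (w + ?x)) / 2 - F ?x / 4"
    unfolding F by (simp add: field_simps)
  moreover have "F (w + (1 / 2) *\<^sub>R ?x) \<le> f (w + (1 / 2) *\<^sub>R ?x)"
    "f (w + (1 / 2) *\<^sub>R ?x) \<le> F (w + (1 / 2) *\<^sub>R ?x) + e"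
    using f unfolding overestimation_def by auto
  ultimately have "0 \<le> ?g w + ?g (w + ?x) + F ?x / 2" "?g w + ?g (w + ?x) + F ?x / 2 \<le> 2 * e"
    by argo+
  then show "w + ?x \<in> vertices \<T> \<and> w - ?x \<in> vertices \<T> \<and>
      0 \<le> ?g w + ?g (w + ?x) + F ?x / 2 \<and> ?g w + ?g (w + ?x) + F ?x / 2 \<le> 2 * e"
    using S(4) minus by blast
qed

lemma vertices_nonempty: "vertices \<T> \<noteq> {}"
proof -
  obtain S where "S \<in> \<T>" using tri by (auto simp: triangulation_def)
  then show ?thesis
  proof (cases rule: triangle_form)
    case (1 d)
    then have "(d + a) extreme_point_of S" using extreme_point_of_triangle[OF nondeg_translate(1)] by blast
    then show ?thesis using \<open>S \<in> \<T>\<close> by (auto simp: vertices_def)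
  next
    case (2 d)
    then have "(d - a) extreme_point_of S" using extreme_point_of_triangle[OF nondeg_translate(2)] by blast
    then show ?thesis using \<open>S \<in> \<T>\<close> by (auto simp: vertices_def)
  qed
qed

text \<open>The maximum \<open>64 / 3 * e\<^sup>2\<close> of Heron's form is the square of
  \<open>8 * sqrt 3 / 3 * e\<close>, which is twice the largest area.\<close>

lemma overestimation_area:
  assumes F: "F = (\<lambda>x. x$1 * x$2)" and f: "overestimation e F \<T> f" and e: "e > 0"
  shows "\<bar>det2 (b - a) (c - a)\<bar> / 2 \<le> 4 * sqrt 3 / 3 * e"
    and "\<bar>det2 (b - a) (c - a)\<bar> / 2 = 4 * sqrt 3 / 3 * e \<Longrightarrow>
      constant_deviation F \<T> f (2 * e / 3) \<or> constant_deviation F \<T> f (e / 3)"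
proof -
  have eb: "edge_bounds (\<lambda>x. f x - F x) e (vertices \<T>) (b - a) (F (b - a))"
    "edge_bounds (\<lambda>x. f x - F x) e (vertices \<T>) (c - b) (F (c - b))"
    "edge_bounds (\<lambda>x. f x - F x) e (vertices \<T>) (a - c) (F (a - c))"
    by (rule overestimation_edge_bounds[OF F f]; simp)+
  have sum: "b - a + (c - b) + (a - c) = 0" by simp
  have bd: "0 \<le> f w - F w" "f w - F w \<le> e" for w
    using f unfolding overestimation_def by (auto simp: algebra_simps)
  note h = edge_bounds_heron[OF eb sum vertices_nonempty e bd]
  \<comment> \<open>This polynomial identity is Heron's formula for \<open>F\<close>: the form
    evaluates to four times the squared area.\<close>
  have heron: "heron (F (b - a)) (F (c - b)) (F (a - c)) = (det2 (b - a) (c - a))\<^sup>2"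
    unfolding F heron_def det2_def by (simp add: power2_eq_square algebra_simps)
  have sq: "(8 * sqrt 3 / 3 * e)\<^sup>2 = 64 / 3 * e\<^sup>2"
  proof -
    have "(8 * sqrt 3 / 3 * e)\<^sup>2 = 64 / 9 * (sqrt 3)\<^sup>2 * e\<^sup>2"
      by (simp only: power2_eq_square) argo
    then show ?thesis by simp
  qed
  have "\<bar>det2 (b - a) (c - a)\<bar>\<^sup>2 \<le> (8 * sqrt 3 / 3 * e)\<^sup>2"
    using h(1) by (simp only: heron sq power2_abs)
  then have "\<bar>det2 (b - a) (c - a)\<bar> \<le> 8 * sqrt 3 / 3 * e"
    by (rule power2_le_imp_le) (use e in simp)
  then show "\<bar>det2 (b - a) (c - a)\<bar> / 2 \<le> 4 * sqrt 3 / 3 * e" by simp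
  assume "\<bar>det2 (b - a) (c - a)\<bar> / 2 = 4 * sqrt 3 / 3 * e"
  then have "\<bar>det2 (b - a) (c - a)\<bar> = 8 * sqrt 3 / 3 * e" by simp
  then have "heron (F (b - a)) (F (c - b)) (F (a - c)) = 64 / 3 * e\<^sup>2"
    unfolding heron using sq by (metis power2_abs)
  from h(2)[OF this] show "constant_deviation F \<T> f (2 * e / 3) \<or> constant_deviation F \<T> f (e / 3)"
    unfolding constant_deviation_def .
qed

end

lemma parallelogram_tiling_congruent:
  assumes "parallelogram_tiling \<T>"
  obtains a b c where "congruent_triangulation \<T> a b c"
proof -
  obtain T T' w V where T: "triangulation \<T>" "triangle T"
    and T': "T' = (+) w ` uminus ` T"
    and eq: "\<T> = (\<Union>v\<in>V. {(+) v ` T, (+) v ` T'})"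
    using assms unfolding parallelogram_tiling_def by (elim conjE exE) (rule that)
  obtain a b c where abc: "det2 (b - a) (c - a) \<noteq> 0" "T = convex hull {a, b, c}"
    using T(2) triangle_iff by blast
  have "congruent_triangulation \<T> a b c"
  proof
    fix S assume "S \<in> \<T>"
    then obtain v where "S = (+) v ` T \<or> S = (+) v ` T'" unfolding eq by auto
    moreover have "(+) v ` T' = (+) (v + w) ` uminus ` T"
      unfolding T' by (simp add: image_image add.assoc)
    ultimately have "S = (+) v ` T \<or> S = (+) (v + w) ` uminus ` T" by simp
    then show "\<exists>d. S = (+) d ` (convex hull {a, b, c}) \<or> S = (+) d ` uminus ` (convex hull {a, b, c})"
      unfolding abc(2) by blast
  qed (use T abc in auto)
  then show thesis by (rule that)
qed

section \<open>Density and area\<close>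

lemma locally_finite_compact:
  assumes "locally_finite_in euclidean \<T>" "compact K"
  shows "finite {S \<in> \<T>. S \<inter> K \<noteq> {}}"
proof -
  have "\<forall>x. \<exists>V. open V \<and> x \<in> V \<and> finite {S \<in> \<T>. S \<inter> V \<noteq> {}}"
    using assms(1) unfolding locally_finite_in_def by auto
  then obtain V where V: "\<And>x. open (V x)" "\<And>x. x \<in> V x" "\<And>x. finite {S \<in> \<T>. S \<inter> V x \<noteq> {}}"
    by metis
  obtain D where D: "D \<subseteq> K" "finite D" "K \<subseteq> (\<Union>x\<in>D. V x)"
    by (rule compactE_image[OF assms(2), of K V]) (use V in auto)
  have "finite (\<Union>x\<in>D. {S \<in> \<T>. S \<inter> V x \<noteq> {}})" using D(2) V(3) by simp
  then show ?thesis by (rule finite_subset[rotated]) (use D(3) in blast)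
qed

lemma centered_square_cbox: "centered_square l = cbox (\<chi> i. - l / 2) (\<chi> i. l / 2)"
  by (auto simp: centered_square_def cbox_def Basis_vec_def inner_axis forall_2 abs_le_iff)

lemma measure_centered_square:
  assumes "0 \<le> l"
  shows "measure lebesgue (centered_square l) = l\<^sup>2"
proof -
  have "cbox (\<chi> i. - l / 2) (\<chi> i. l / 2) \<noteq> ({} :: (real^2) set)"
    using assms by (simp add: interval_ne_empty_cart)
  from content_cbox_cart[OF this] show ?thesis
    unfolding centered_square_cbox by (simp add: prod_constant)
qed

text \<open>A proper face lies in the boundary of the triangle, and the boundary of a convex set is
  a null set.\<close>

lemma triangulation_negligible:
  assumes "triangulation \<T>" "S \<in> \<T>" "T \<in> \<T>" "S \<noteq> T"
  shows "negligible (S \<inter> T)"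
proof (cases "S \<inter> T = {}")
  case False
  then have f: "(S \<inter> T) face_of S" "S \<inter> T \<noteq> S"
    using assms unfolding triangulation_def by metis+
  have "convex S" using assms by (auto simp: triangulation_def intro: convex_simplex)
  have "S \<inter> T \<subseteq> rel_frontier S"
    using face_of_subset_rel_frontier[OF f] .
  also have "\<dots> \<subseteq> frontier S"
    using interior_subset_rel_interior by (auto simp: rel_frontier_def frontier_def)
  finally show ?thesis
    using negligible_convex_frontier[OF \<open>convex S\<close>] negligible_subset by blast
qed simp

text \<open>The triangles meeting the square cover it, overlap in null sets and stay inside the
  square widened by \<open>R\<close> on each side, so their total area lies between the areas of the
  two squares.\<close>

lemma triangulation_count:
  assumes T: "triangulation \<T>"
    and A: "\<And>S. S \<in> \<T> \<Longrightarrow> measure lebesgue S = A"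
    and R: "\<And>S x y i. S \<in> \<T> \<Longrightarrow> x \<in> S \<Longrightarrow> y \<in> S \<Longrightarrow> \<bar>x$i - y$i\<bar> \<le> R"
    and l: "0 < l" and R0: "0 \<le> R"
  defines "N \<equiv> card {S \<in> \<T>. S \<inter> centered_square l \<noteq> {}}"
  shows "l\<^sup>2 \<le> real N * A" "real N * A \<le> (l + 2 * R)\<^sup>2"
proof -
  define M where "M = {S \<in> \<T>. S \<inter> centered_square l \<noteq> {}}"
  have fin: "finite M"
    unfolding M_def using T by (intro locally_finite_compact) (auto simp: triangulation_def centered_square_cbox)
  have meas: "S \<in> lmeasurable" if "S \<in> M" for S
    using that T by (auto simp: triangulation_def M_def intro!: lmeasurable_compact compact_simplex)
  have "pairwise (\<lambda>S T. negligible (S \<inter> T)) M"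
    using triangulation_negligible[OF T] by (auto simp: pairwise_def M_def)
  from measure_negligible_finite_Union[OF fin meas this]
  have NA: "measure lebesgue (\<Union>M) = real N * A"
    using A by (simp add: N_def M_def)
  have UM: "\<Union>M \<in> lmeasurable" using fin meas by (intro fmeasurable.finite_Union) auto
  have "centered_square l \<subseteq> \<Union>M"
  proof
    fix x assume x: "x \<in> centered_square l"
    have "x \<in> \<Union>\<T>" using T by (simp add: triangulation_def)
    then obtain S where "S \<in> \<T>" "x \<in> S" by blast
    then show "x \<in> \<Union>M" using x by (auto simp: M_def)
  qed
  then have "measure lebesgue (centered_square l) \<le> measure lebesgue (\<Union>M)"
    by (intro measure_mono_fmeasurable UM) (auto simp: centered_square_cbox)
  then show "l\<^sup>2 \<le> real N * A" using NA measure_centered_square l by simp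
  have "\<Union>M \<subseteq> centered_square (l + 2 * R)"
  proof
    fix x assume "x \<in> \<Union>M"
    then obtain S y where S: "S \<in> \<T>" "x \<in> S" "y \<in> S" "y \<in> centered_square l" by (auto simp: M_def)
    have "\<bar>x$i - y$i\<bar> \<le> R" for i using R S by blast
    from this[of 1] this[of 2] S(4) show "x \<in> centered_square (l + 2 * R)"
      unfolding centered_square_def by (simp add: field_simps) linarith
  qed
  then have "measure lebesgue (\<Union>M) \<le> measure lebesgue (centered_square (l + 2 * R))"
    by (intro measure_mono_fmeasurable) (use UM in \<open>auto simp: centered_square_cbox\<close>)
  then show "real N * A \<le> (l + 2 * R)\<^sup>2" using NA measure_centered_square l R0 by simp
qed

text \<open>After division by \<open>l\<^sup>2\<close> both area bounds tend to the same value, so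
  the upper limit is a limit.\<close>

lemma triangulation_density:
  assumes T: "triangulation \<T>"
    and A: "\<And>S. S \<in> \<T> \<Longrightarrow> measure lebesgue S = A" and A0: "0 < A"
    and R: "\<And>S x y i. S \<in> \<T> \<Longrightarrow> x \<in> S \<Longrightarrow> y \<in> S \<Longrightarrow> \<bar>x$i - y$i\<bar> \<le> R" and R0: "0 \<le> R"
  shows "triangle_density \<T> = ereal (1 / A)"
proof -
  let ?N = "\<lambda>l. real (card {S \<in> \<T>. S \<inter> centered_square l \<noteq> {}})"
  note count = triangulation_count[OF T A R _ R0]
  have low: "1 / A \<le> ?N l / l\<^sup>2" if "0 < l" for l
    using count(1)[OF _ _ _ _ that] that A0 by (simp add: field_simps)
  have up: "?N l / l\<^sup>2 \<le> (1 + 2 * R / l)\<^sup>2 / A" if "0 < l" for l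
  proof -
    define k where "k = (1 + 2 * R / l)\<^sup>2"
    have "?N l * A \<le> (l * (1 + 2 * R / l))\<^sup>2"
      using count(2)[OF _ _ _ _ that] that by (simp add: distrib_left)
    then have "?N l * A \<le> l\<^sup>2 * k" by (simp only: power_mult_distrib k_def)
    then show ?thesis using that A0 unfolding k_def[symmetric] by (simp add: field_simps)
  qed
  have "((\<lambda>l. (1 + 2 * R / l)\<^sup>2 / A) \<longlongrightarrow> (1 + 0)\<^sup>2 / A) at_top"
    by (intro tendsto_intros real_tendsto_divide_at_top filterlim_ident) (use A0 in auto)
  then have lim: "((\<lambda>l. (1 + 2 * R / l)\<^sup>2 / A) \<longlongrightarrow> 1 / A) at_top" by simp
  have "((\<lambda>l. ?N l / l\<^sup>2) \<longlongrightarrow> 1 / A) at_top"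
  proof (rule tendsto_sandwich[OF _ _ tendsto_const lim])
    show "\<forall>\<^sub>F l in at_top. 1 / A \<le> ?N l / l\<^sup>2"
      by (rule eventually_mono[OF eventually_gt_at_top[of 0] low])
    show "\<forall>\<^sub>F l in at_top. ?N l / l\<^sup>2 \<le> (1 + 2 * R / l)\<^sup>2 / A"
      by (rule eventually_mono[OF eventually_gt_at_top[of 0] up])
  qed
  then show ?thesis
    unfolding triangle_density_def by (intro lim_imp_Limsup) auto
qed

lemma (in congruent_triangulation) triangle_density_eq:
  "triangle_density \<T> = ereal (1 / (\<bar>det2 (b - a) (c - a)\<bar> / 2))"
proof (rule triangulation_density[OF tri measure_triangle])
  let ?T = "convex hull {a, b, c}"
  have "bounded ?T" by (simp add: finite_imp_bounded_convex_hull)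
  then show "0 \<le> diameter ?T" by (rule diameter_ge_0)
  fix S x y and i :: 2
  assume S: "S \<in> \<T>" and xy: "x \<in> S" "y \<in> S"
  have *: "\<bar>u$i - v$i\<bar> \<le> diameter ?T" if "u \<in> ?T" "v \<in> ?T" for u v
  proof -
    have "\<bar>(u - v)$i\<bar> \<le> norm (u - v)" by (rule component_le_norm_cart)
    also have "\<dots> \<le> diameter ?T"
      using diameter_bounded_bound[OF \<open>bounded ?T\<close> that] by (simp add: dist_norm)
    finally show ?thesis by simp
  qed
  obtain d where "S = (+) d ` ?T \<or> S = (+) d ` uminus ` ?T" using copy[OF S] by blast
  then show "\<bar>x$i - y$i\<bar> \<le> diameter ?T"
  proof
    assume "S = (+) d ` ?T"
    then show ?thesis using xy * by auto
  next
    assume "S = (+) d ` uminus ` ?T"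
    then obtain u v where "u \<in> ?T" "v \<in> ?T" "x = d - u" "y = d - v" using xy by auto
    then show ?thesis using *[of v u] by simp
  qed
qed (use nondeg in auto)

section \<open>A lattice triangulation and its interpolation\<close>

text \<open>The excess over \<open>r\<^sup>2\<close> of its piecewise linear interpolation at the
  integers: \<open>r\<^sup>2 + bump r\<close> is affine between consecutive integers.\<close>

definition bump :: "real \<Rightarrow> real" where
  "bump r = frac r * (1 - frac r)"

text \<open>The right end is allowed: \<open>frac\<close> has dropped to \<open>0\<close> there, but
  the formula vanishes as well.\<close>

lemma bump_eq:
  assumes "of_int k \<le> r" "r \<le> of_int k + 1"
  shows "bump r = (r - of_int k) * (1 - (r - of_int k))"
proof (cases "r = of_int k + 1")
  case True
  then have "r = of_int (k + 1)" by simp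
  then show ?thesis using True by (simp only: bump_def frac_of_int) simp
next
  case False
  then have "floor r = k" using assms by (intro floor_unique) auto
  then show ?thesis by (simp add: bump_def frac_def)
qed

lemma bump_of_int: "bump (of_int k) = 0"
  by (simp add: bump_def)

lemma bump_bounds: "0 \<le> bump r" "bump r \<le> 1 / 4"
proof -
  show "0 \<le> bump r"
    unfolding bump_def using frac_ge_0[of r] frac_lt_1[of r] by (intro mult_nonneg_nonneg) auto
  have "0 \<le> (frac r - 1 / 2)\<^sup>2" by simp
  then show "bump r \<le> 1 / 4" by (simp add: bump_def power2_eq_square algebra_simps)
qed

text \<open>The two arcs adjacent to an integer are given by a single formula with an absolute
  value, and every real has a neighbourhood on which such a formula holds.\<close>

lemma continuous_on_bump: "continuous_on UNIV bump"
proof (intro continuous_at_imp_continuous_on ballI)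
  fix x :: real
  define k where "k = floor x"
  have eq: "bump r = \<bar>r - of_int k\<bar> - (r - of_int k)\<^sup>2" if "r \<in> {of_int k - 1<..<of_int k + 1}" for r
  proof (cases "of_int k \<le> r")
    case True
    then show ?thesis using that bump_eq[of k r] by (simp add: power2_eq_square algebra_simps)
  next
    case False
    then show ?thesis using that bump_eq[of "k - 1" r] by (simp add: power2_eq_square algebra_simps)
  qed
  have cont: "isCont (\<lambda>r. \<bar>r - of_int k\<bar> - (r - of_int k)\<^sup>2) x"
    by (intro continuous_intros)
  have "x \<in> {of_int k - 1<..<of_int k + 1}"
    unfolding k_def using floor_correct[of x] by simp linarith
  then have "\<forall>\<^sub>F r in nhds x. r \<in> {of_int k - 1<..<of_int k + 1}"
    by (intro eventually_nhds_in_open) auto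
  then have "\<forall>\<^sub>F r in nhds x. bump r = \<bar>r - of_int k\<bar> - (r - of_int k)\<^sup>2"
    by (rule eventually_mono) (rule eq)
  from isCont_cong[OF this] show "isCont bump x" using cont by simp
qed

text \<open>Completing the square leaves \<open>1 / 4\<close> minus a square and a product that is
  nonnegative on this triangle. Equality holds at the midpoints of the legs \<open>v = 0\<close> and
  \<open>u = 1\<close>.\<close>

lemma bump_combination_le:
  assumes "0 \<le> v" "v \<le> u" "u \<le> (1::real)"
  shows "2 * ((u - v) * (1 - (u - v))) - u * (1 - u) - v * (1 - v) \<le> 1 / 4"
proof -
  have "2 * ((u - v) * (1 - (u - v))) - u * (1 - u) - v * (1 - v)
      = 1 / 4 - (u - v - 1 / 2)\<^sup>2 - 2 * ((1 - u) * v)"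
    by (simp add: power2_eq_square algebra_simps)
  moreover have "0 \<le> (1 - u) * v" "0 \<le> (u - v - 1 / 2)\<^sup>2" using assms by simp_all
  ultimately show ?thesis by linarith
qed

section \<open>Cells of a triangular lattice\<close>

lemma translate_image: "(+) v ` A = {z. z - v \<in> A}" for v :: "'a::ab_group_add"
proof (intro set_eqI iffI)
  fix z assume "z \<in> {z. z - v \<in> A}"
  then have "v + (z - v) \<in> (+) v ` A" by blast
  then show "z \<in> (+) v ` A" by simp
qed auto

text \<open>This is the face property in one coordinate. Distinct intervals between consecutive
  integers share at most an endpoint, and a proper convex combination reaches an endpoint only if
  both points are equal to it.\<close>

lemma convex_combination_in_unit_interval:
  fixes x y u :: real and k k' :: int
  assumes u: "0 < u" "u < 1" and x: "of_int k \<le> x" "x \<le> of_int k + 1"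
    and y: "of_int k \<le> y" "y \<le> of_int k + 1"
    and z: "of_int k' \<le> (1 - u) * x + u * y" "(1 - u) * x + u * y \<le> of_int k' + 1"
  shows "of_int k' \<le> x \<and> x \<le> of_int k' + 1 \<and> of_int k' \<le> y \<and> y \<le> of_int k' + 1"
proof (rule linorder_cases[of k k'])
  assume "k = k'"
  then show ?thesis using assms by simp
next
  assume "k < k'"
  then have k: "of_int k + 1 \<le> (of_int k' :: real)" by linarith
  have "(1 - u) * (of_int k + 1 - x) + u * (of_int k + 1 - y) \<le> 0"
    using z(1) k by (simp add: algebra_simps)
  moreover have "0 \<le> (1 - u) * (of_int k + 1 - x)" "0 \<le> u * (of_int k + 1 - y)"
    using u x y by auto
  ultimately have "(1 - u) * (of_int k + 1 - x) = 0" "u * (of_int k + 1 - y) = 0" by linarith+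
  then have xy: "x = of_int k + 1" "y = of_int k + 1" using u by auto
  then have "(1 - u) * x + u * y = of_int k + 1" by (simp add: algebra_simps)
  then show ?thesis using z xy by simp
next
  assume "k' < k"
  then have k: "of_int k' + 1 \<le> (of_int k :: real)" by linarith
  have "(1 - u) * (x - of_int k) + u * (y - of_int k) \<le> 0"
    using z(2) k by (simp add: algebra_simps)
  moreover have "0 \<le> (1 - u) * (x - of_int k)" "0 \<le> u * (y - of_int k)"
    using u x y by auto
  ultimately have "(1 - u) * (x - of_int k) = 0" "u * (y - of_int k) = 0" by linarith+
  then have xy: "x = of_int k" "y = of_int k" using u by auto
  then have "(1 - u) * x + u * y = of_int k" by (simp add: algebra_simps)
  then show ?thesis using z xy by simp
qed

locale lattice_basis =
  fixes X Y :: "real^2"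
  assumes basis: "det2 X Y \<noteq> 0"
begin

text \<open>Coordinates with respect to \<open>X\<close> and \<open>Y\<close>, by Cramer's
  rule.\<close>

definition cs :: "real^2 \<Rightarrow> real" where "cs z = det2 z Y / det2 X Y"
definition ct :: "real^2 \<Rightarrow> real" where "ct z = det2 X z / det2 X Y"

lemma coord_simps [simp]:
  "cs X = 1" "cs Y = 0" "ct X = 0" "ct Y = 1" "cs 0 = 0" "ct 0 = 0"
  "cs (x + y) = cs x + cs y" "ct (x + y) = ct x + ct y"
  "cs (x - y) = cs x - cs y" "ct (x - y) = ct x - ct y"
  "cs (u *\<^sub>R x) = u * cs x" "ct (u *\<^sub>R x) = u * ct x"
  using basis unfolding cs_def ct_def
  by (simp_all add: det2_def diff_divide_distrib[symmetric] add_divide_distrib[symmetric] algebra_simps)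

lemma coord_minus [simp]: "cs (- x) = - cs x" "ct (- x) = - ct x"
  using coord_simps(9,10)[of 0 x] by simp_all

lemma coord_expand: "z = cs z *\<^sub>R X + ct z *\<^sub>R Y"
proof -
  have "det2 X Y *\<^sub>R z = det2 z Y *\<^sub>R X + det2 X z *\<^sub>R Y"
    by (simp add: vec2_eq_iff det2_def algebra_simps)
  then have "inverse (det2 X Y) *\<^sub>R det2 X Y *\<^sub>R z = inverse (det2 X Y) *\<^sub>R (det2 z Y *\<^sub>R X + det2 X z *\<^sub>R Y)"
    by simp
  then show ?thesis using basis by (simp add: cs_def ct_def scaleR_add_right divide_inverse mult.commute)
qed

lemma coord_inner: "\<exists>p. \<forall>z. cs z = p \<bullet> z" "\<exists>p. \<forall>z. ct z = p \<bullet> z"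
proof -
  have "cs z = vector [Y$2 / det2 X Y, - Y$1 / det2 X Y] \<bullet> z" for z
    by (simp add: cs_def inner_vec_def sum_2 det2_def diff_divide_distrib mult.commute)
  then show "\<exists>p. \<forall>z. cs z = p \<bullet> z" by blast
  have "ct z = vector [- X$2 / det2 X Y, X$1 / det2 X Y] \<bullet> z" for z
    by (simp add: ct_def inner_vec_def sum_2 det2_def diff_divide_distrib mult.commute)
  then show "\<exists>p. \<forall>z. ct z = p \<bullet> z" by blast
qed

lemma continuous_on_coord [continuous_intros]: "continuous_on A cs" "continuous_on A ct"
proof -
  obtain p q where p: "\<And>z. cs z = p \<bullet> z" and q: "\<And>z. ct z = q \<bullet> z"
    using coord_inner by blast
  show "continuous_on A cs" unfolding p by (intro continuous_intros)
  show "continuous_on A ct" unfolding q by (intro continuous_intros)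
qed

text \<open>
  The cells of the arrangement of the lines where \<open>cs\<close>, \<open>ct\<close> or \<open>cs - ct\<close> is an integer. Such a
  cell has nonempty interior only if \<open>k\<close> is \<open>m - n\<close> or \<open>m - n - 1\<close>.
\<close>

definition cell :: "int \<Rightarrow> int \<Rightarrow> int \<Rightarrow> (real^2) set" where
  "cell m n k = {z. of_int m \<le> cs z \<and> cs z \<le> of_int m + 1 \<and> of_int n \<le> ct z \<and> ct z \<le> of_int n + 1
     \<and> of_int k \<le> cs z - ct z \<and> cs z - ct z \<le> of_int k + 1}"

definition cells :: "(real^2) set set" where
  "cells = {cell m n k | m n k. k = m - n \<or> k = m - n - 1}"

definition lattice :: "(real^2) set" where
  "lattice = {of_int m *\<^sub>R X + of_int n *\<^sub>R Y | m n. True}"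

lemma cell_0: "cell 0 0 0 \<in> cells"
  unfolding cells_def by (intro CollectI exI[of _ "0::int"]) simp

lemma cell_translate: "(+) (of_int m *\<^sub>R X + of_int n *\<^sub>R Y) ` cell 0 0 k = cell m n (m - n + k)"
  unfolding translate_image cell_def by (auto simp: algebra_simps)

lemma cell_reflect: "(+) (X + Y) ` uminus ` cell 0 0 0 = cell 0 0 (- 1)"
proof -
  have "uminus ` A = {z. - z \<in> A}" for A :: "(real^2) set" by force
  then show ?thesis unfolding translate_image cell_def by (auto simp: algebra_simps)
qed

lemma cell_hull: "cell 0 0 0 = convex hull {0, X, X + Y}"
proof (intro set_eqI iffI)
  fix z assume z: "z \<in> cell 0 0 0"
  \<comment> \<open>The barycentric coordinates are the slacks in
    \<open>0 \<le> ct z \<le> cs z \<le> 1\<close>.\<close>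
  have "z = (1 - cs z) *\<^sub>R 0 + (cs z - ct z) *\<^sub>R X + ct z *\<^sub>R (X + Y)"
    by (subst coord_expand[of z]) (simp add: algebra_simps)
  then show "z \<in> convex hull {0, X, X + Y}"
    unfolding convex_hull_3 using z unfolding cell_def
    by (intro CollectI exI[of _ "1 - cs z"] exI[of _ "cs z - ct z"] exI[of _ "ct z"]) auto
next
  fix z assume "z \<in> convex hull {0, X, X + Y}"
  then obtain u v w where "0 \<le> u" "0 \<le> v" "0 \<le> w" "u + v + w = 1" "z = u *\<^sub>R 0 + v *\<^sub>R X + w *\<^sub>R (X + Y)"
    unfolding convex_hull_3 by auto
  then show "z \<in> cell 0 0 0" by (simp add: cell_def)
qed

lemma cells_eq: "cells = (\<Union>v\<in>lattice. {(+) v ` cell 0 0 0, (+) v ` cell 0 0 (- 1)})" (is "_ = ?R")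
proof (intro set_eqI iffI)
  fix S assume "S \<in> cells"
  then obtain m n k where k: "S = cell m n k" "k = m - n \<or> k = m - n - 1" unfolding cells_def by blast
  let ?v = "of_int m *\<^sub>R X + of_int n *\<^sub>R Y"
  have "S = (+) ?v ` cell 0 0 0 \<or> S = (+) ?v ` cell 0 0 (- 1)"
    unfolding cell_translate using k by auto
  moreover have "?v \<in> lattice" unfolding lattice_def by blast
  ultimately show "S \<in> ?R" by blast
next
  fix S assume "S \<in> ?R"
  then obtain v where v: "v \<in> lattice" "S = (+) v ` cell 0 0 0 \<or> S = (+) v ` cell 0 0 (- 1)" by blast
  then obtain m n where "v = of_int m *\<^sub>R X + of_int n *\<^sub>R Y" unfolding lattice_def by blast
  then have "S = cell m n (m - n) \<or> S = cell m n (m - n - 1)" using v(2) by (simp add: cell_translate)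
  then show "S \<in> cells" unfolding cells_def by blast
qed

text \<open>A cell with \<open>k = m - n - 1\<close> is a reflected copy of
  \<open>cell 0 0 0\<close>, so it is described from its far corner, again a lattice point.\<close>

lemma cells_hull:
  assumes "S \<in> cells"
  obtains v where "v \<in> lattice" "S = convex hull {v, v + X, v + (X + Y)}"
  | v where "v \<in> lattice" "S = convex hull {v, v - X, v - (X + Y)}"
proof -
  obtain v where v: "v \<in> lattice" "S = (+) v ` cell 0 0 0 \<or> S = (+) v ` cell 0 0 (- 1)"
    using assms unfolding cells_eq by blast
  obtain m n where mn: "v = of_int m *\<^sub>R X + of_int n *\<^sub>R Y" using v(1) unfolding lattice_def by blast
  have "v + (X + Y) = of_int (m + 1) *\<^sub>R X + of_int (n + 1) *\<^sub>R Y"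
    by (simp add: mn algebra_simps)
  then have v': "v + (X + Y) \<in> lattice" unfolding lattice_def by blast
  have "(+) v ` cell 0 0 0 = convex hull {v, v + X, v + (X + Y)}"
    unfolding cell_hull triangle_translate by simp
  moreover have "(+) v ` cell 0 0 (- 1) =
      convex hull {v + (X + Y), v + (X + Y) - X, v + (X + Y) - (X + Y)}"
    unfolding cell_reflect[symmetric] cell_hull triangle_uminus triangle_translate by (simp add: add_diff_eq)
  ultimately show thesis using v v' that by metis
qed

lemma triangle_cells: "S \<in> cells \<Longrightarrow> triangle S"
proof (erule cells_hull)
  fix v assume "S = convex hull {v, v + X, v + (X + Y)}"
  moreover have "det2 (v + X - v) (v + (X + Y) - v) \<noteq> 0" using basis by (simp add: det2_def algebra_simps)
  ultimately show ?thesis unfolding triangle_iff by blast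
next
  fix v assume "S = convex hull {v, v - X, v - (X + Y)}"
  moreover have "det2 (v - X - v) (v - (X + Y) - v) \<noteq> 0" using basis by (simp add: det2_def algebra_simps)
  ultimately show ?thesis unfolding triangle_iff by blast
qed

lemma cells_cover: "\<exists>S\<in>cells. z \<in> S"
proof -
  define m n where "m = floor (cs z)" and "n = floor (ct z)"
  have b: "of_int m \<le> cs z" "cs z < of_int m + 1" "of_int n \<le> ct z" "ct z < of_int n + 1"
    by (simp_all add: m_def n_def)
  show ?thesis
  proof (cases "of_int m - of_int n \<le> cs z - ct z")
    case True
    then have "z \<in> cell m n (m - n)" using b by (simp add: cell_def)
    then show ?thesis unfolding cells_def by blast
  next
    case False
    then have "z \<in> cell m n (m - n - 1)" using b by (simp add: cell_def)
    then show ?thesis unfolding cells_def by blast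
  qed
qed

lemma locally_finite_cells: "locally_finite_in euclidean cells"
  unfolding locally_finite_in_def
proof (intro conjI ballI)
  fix x :: "real^2"
  \<comment> \<open>On \<open>V\<close> both coordinates stay within \<open>1\<close> of those of
    \<open>x\<close>, which confines the indices of the cells meeting \<open>V\<close> to a finite
    range.\<close>
  define V where "V = {z. \<bar>cs z - cs x\<bar> < 1} \<inter> {z. \<bar>ct z - ct x\<bar> < 1}"
  have "open V"
    unfolding V_def by (intro open_Int open_Collect_less continuous_intros)
  moreover have "x \<in> V" by (simp add: V_def)
  moreover have "finite {S \<in> cells. S \<inter> V \<noteq> {}}"
  proof -
    define m n where "m = floor (cs x)" and "n = floor (ct x)"
    have b: "of_int m \<le> cs x" "cs x < of_int m + 1" "of_int n \<le> ct x" "ct x < of_int n + 1"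
      by (simp_all add: m_def n_def)
    have "{S \<in> cells. S \<inter> V \<noteq> {}} \<subseteq>
        (\<lambda>(m', n', j). cell m' n' (m' - n' - j)) ` ({m - 2..m + 2} \<times> {n - 2..n + 2} \<times> {0, 1})"
    proof
      fix S assume "S \<in> {S \<in> cells. S \<inter> V \<noteq> {}}"
      then obtain m' n' k z where S: "S = cell m' n' k" "k = m' - n' \<or> k = m' - n' - 1" "z \<in> S" "z \<in> V"
        unfolding cells_def by blast
      have "of_int m' < (of_int (m + 3) :: real)" "of_int (m - 3) < (of_int m' :: real)"
        "of_int n' < (of_int (n + 3) :: real)" "of_int (n - 3) < (of_int n' :: real)"
        using S(3,4) b unfolding S(1) cell_def V_def by auto
      then have "m' \<in> {m - 2..m + 2}" "n' \<in> {n - 2..n + 2}" unfolding of_int_less_iff by auto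
      moreover have "S = cell m' n' (m' - n' - 0) \<or> S = cell m' n' (m' - n' - 1)" using S(1,2) by auto
      ultimately show "S \<in> (\<lambda>(m', n', j). cell m' n' (m' - n' - j)) ` ({m - 2..m + 2} \<times> {n - 2..n + 2} \<times> {0, 1})"
        by force
    qed
    then show ?thesis by (rule finite_subset) auto
  qed
  ultimately show "\<exists>V. openin euclidean V \<and> x \<in> V \<and> finite {U \<in> cells. U \<inter> V \<noteq> {}}"
    by auto
qed auto

lemma convex_cell: "k = m - n \<or> k = m - n - 1 \<Longrightarrow> convex (cell m n k)"
  by (rule convex_simplex, rule triangle_cells) (unfold cells_def, blast)

text \<open>A cell is cut out by one unit interval for each of \<open>cs\<close>, \<open>ct\<close>
  and \<open>cs - ct\<close>, all affine along a segment, so the face property in one coordinate is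
  applied three times.\<close>

lemma cell_Int_face:
  assumes "k = m - n \<or> k = m - n - 1" "k' = m' - n' \<or> k' = m' - n' - 1"
  shows "(cell m n k \<inter> cell m' n' k') face_of cell m n k"
  unfolding face_of_def
proof (intro conjI ballI impI)
  show "convex (cell m n k \<inter> cell m' n' k')" using assms by (intro convex_Int convex_cell)
  fix x y z assume x: "x \<in> cell m n k" and y: "y \<in> cell m n k" and z: "z \<in> cell m n k \<inter> cell m' n' k'"
    and "z \<in> open_segment x y"
  then obtain u where u: "0 < u" "u < 1" "z = (1 - u) *\<^sub>R x + u *\<^sub>R y" by (auto simp: in_segment)
  note conv = convex_combination_in_unit_interval[OF u(1,2)]
  have c: "cs z = (1 - u) * cs x + u * cs y" "ct z = (1 - u) * ct x + u * ct y"
    "cs z - ct z = (1 - u) * (cs x - ct x) + u * (cs y - ct y)"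
    by (simp_all add: u(3) algebra_simps)
  have "of_int m' \<le> cs x \<and> cs x \<le> of_int m' + 1 \<and> of_int m' \<le> cs y \<and> cs y \<le> of_int m' + 1"
    using x y z unfolding cell_def by (intro conv[of m]) (auto simp flip: c)
  moreover have "of_int n' \<le> ct x \<and> ct x \<le> of_int n' + 1 \<and> of_int n' \<le> ct y \<and> ct y \<le> of_int n' + 1"
    using x y z unfolding cell_def by (intro conv[of n]) (auto simp flip: c)
  moreover have "of_int k' \<le> cs x - ct x \<and> cs x - ct x \<le> of_int k' + 1 \<and>
      of_int k' \<le> cs y - ct y \<and> cs y - ct y \<le> of_int k' + 1"
    using x y z unfolding cell_def by (intro conv[of k]) (auto simp flip: c)
  ultimately show "x \<in> cell m n k \<inter> cell m' n' k'" "y \<in> cell m n k \<inter> cell m' n' k'"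
    using x y unfolding cell_def by auto
qed simp

text \<open>At the barycentre of a cell all three coordinates lie strictly between consecutive
  integers and so determine the indices.\<close>

lemma cell_subset_imp_eq:
  assumes k: "k = m - n \<or> k = m - n - 1" and sub: "cell m n k \<subseteq> cell m' n' k'"
  shows "m' = m \<and> n' = n \<and> k' = k"
proof -
  have int: "i' = i" if "of_int i < r" "r < of_int i + 1" "of_int i' \<le> r" "r \<le> of_int i' + 1" for r :: real and i i'
  proof -
    have "of_int i' < (of_int (i + 1) :: real)" "of_int i < (of_int (i' + 1) :: real)" using that by auto
    then show ?thesis unfolding of_int_less_iff by simp
  qed
  from k have "\<exists>z. of_int m < cs z \<and> cs z < of_int m + 1 \<and> of_int n < ct z \<and> ct z < of_int n + 1 \<and>
      of_int k < cs z - ct z \<and> cs z - ct z < of_int k + 1"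
  proof
    assume "k = m - n"
    then show ?thesis by (intro exI[of _ "(of_int m + 2 / 3) *\<^sub>R X + (of_int n + 1 / 3) *\<^sub>R Y"]) simp
  next
    assume "k = m - n - 1"
    then show ?thesis by (intro exI[of _ "(of_int m + 1 / 3) *\<^sub>R X + (of_int n + 2 / 3) *\<^sub>R Y"]) simp
  qed
  then obtain z where z: "of_int m < cs z" "cs z < of_int m + 1" "of_int n < ct z" "ct z < of_int n + 1"
      "of_int k < cs z - ct z" "cs z - ct z < of_int k + 1" by blast
  then have "z \<in> cell m n k" by (simp add: cell_def)
  then have z': "z \<in> cell m' n' k'" using sub by blast
  then show ?thesis
    using int[OF z(1,2)] int[OF z(3,4)] int[OF z(5,6)] unfolding cell_def by simp
qed

lemma triangulation_cells: "triangulation cells"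
  unfolding triangulation_def
proof (intro conjI ballI impI)
  show "\<Union>cells = UNIV" using cells_cover by blast
  fix S T assume "S \<in> cells" "T \<in> cells" and ne: "S \<noteq> T"
  then obtain m n k m' n' k' where S: "S = cell m n k" "k = m - n \<or> k = m - n - 1"
    and T: "T = cell m' n' k'" "k' = m' - n' \<or> k' = m' - n' - 1"
    unfolding cells_def by blast
  have "(S \<inter> T) face_of S" "(T \<inter> S) face_of T"
    unfolding S(1) T(1) using S(2) T(2) by (intro cell_Int_face; simp)+
  moreover have "\<not> S \<subseteq> T" "\<not> T \<subseteq> S"
    using cell_subset_imp_eq[OF S(2), of m' n' k'] cell_subset_imp_eq[OF T(2), of m n k] ne
    unfolding S(1) T(1) by auto
  ultimately show "S \<inter> T = {} \<or> (S \<inter> T) face_of S \<and> (S \<inter> T) face_of T \<and> S \<inter> T \<noteq> S \<and> S \<inter> T \<noteq> T"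
    by (simp add: Int_commute) blast
qed (use triangle_cells locally_finite_cells in auto)

lemma unit_cell: "cell 0 0 0 \<union> cell 0 0 (- 1) = {z. 0 \<le> cs z \<and> cs z \<le> 1 \<and> 0 \<le> ct z \<and> ct z \<le> 1}"
  unfolding cell_def by auto

lemma parallelogram_unit_cell: "parallelogram (cell 0 0 0 \<union> cell 0 0 (- 1))"
  unfolding parallelogram_def
proof (intro exI conjI)
  show "X \<noteq> Y" using basis by (auto simp: det2_def)
  have "X \<notin> span {Y}"
  proof
    assume "X \<in> span {Y}"
    then obtain k where "X = k *\<^sub>R Y" by (auto simp: span_singleton)
    then show False using basis by (simp add: det2_def)
  qed
  moreover have "Y \<noteq> 0" using basis by (auto simp: det2_def)
  ultimately show "independent {X, Y}" using \<open>X \<noteq> Y\<close> by (simp add: independent_insert)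
  show "cell 0 0 0 \<union> cell 0 0 (- 1) = {0 + s *\<^sub>R X + t *\<^sub>R Y | s t. 0 \<le> s \<and> s \<le> 1 \<and> 0 \<le> t \<and> t \<le> 1}"
    unfolding unit_cell
  proof (intro set_eqI iffI)
    fix z assume "z \<in> {z. 0 \<le> cs z \<and> cs z \<le> 1 \<and> 0 \<le> ct z \<and> ct z \<le> 1}"
    then show "z \<in> {0 + s *\<^sub>R X + t *\<^sub>R Y | s t. 0 \<le> s \<and> s \<le> 1 \<and> 0 \<le> t \<and> t \<le> 1}"
      using coord_expand[of z] by (intro CollectI exI[of _ "cs z"] exI[of _ "ct z"]) simp
  qed auto
qed

text \<open>From an interior point a small step along \<open>X + Y\<close> stays in the
  parallelogram, so both coordinates are strictly below their upper bounds. Hence an interior point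
  determines its translate.\<close>

lemma interior_unit_cell:
  assumes "z \<in> interior ((+) (of_int m *\<^sub>R X + of_int n *\<^sub>R Y) ` (cell 0 0 0 \<union> cell 0 0 (- 1)))"
  shows "floor (cs z) = m \<and> floor (ct z) = n"
proof -
  let ?P = "(+) (of_int m *\<^sub>R X + of_int n *\<^sub>R Y) ` (cell 0 0 0 \<union> cell 0 0 (- 1))"
  have P: "?P = {z. of_int m \<le> cs z \<and> cs z \<le> of_int m + 1 \<and> of_int n \<le> ct z \<and> ct z \<le> of_int n + 1}"
    unfolding unit_cell translate_image by (auto simp: algebra_simps)
  obtain e where e: "e > 0" "cball z e \<subseteq> ?P" using assms by (auto simp: mem_interior_cball)
  have "cs (X + Y) \<noteq> cs 0" by simp
  then have "X + Y \<noteq> 0" by metis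
  then have "0 < norm (X + Y)" by simp
  define d where "d = e / norm (X + Y)"
  have d: "d > 0" using e \<open>0 < norm (X + Y)\<close> by (simp add: d_def)
  have "z + d *\<^sub>R (X + Y) \<in> cball z e" "z \<in> cball z e"
    using e \<open>0 < norm (X + Y)\<close> by (simp_all add: dist_norm d_def)
  then have "z + d *\<^sub>R (X + Y) \<in> ?P" "z \<in> ?P" using e by blast+
  then show ?thesis using d unfolding P by (auto intro!: floor_unique)
qed

lemma tiles_cells: "tiles_by_translation (cell 0 0 0 \<union> cell 0 0 (- 1)) lattice"
  unfolding tiles_by_translation_def
proof (intro conjI ballI impI)
  show "(\<Union>v\<in>lattice. (+) v ` (cell 0 0 0 \<union> cell 0 0 (- 1))) = UNIV"
    using cells_cover unfolding cells_eq by blast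
  fix v v' assume v: "v \<in> lattice" "v' \<in> lattice" "v \<noteq> v'"
  obtain m n m' n' where mn: "v = of_int m *\<^sub>R X + of_int n *\<^sub>R Y" "v' = of_int m' *\<^sub>R X + of_int n' *\<^sub>R Y"
    using v(1,2) unfolding lattice_def by blast
  show "interior ((+) v ` (cell 0 0 0 \<union> cell 0 0 (- 1))) \<inter> interior ((+) v' ` (cell 0 0 0 \<union> cell 0 0 (- 1))) = {}"
    using interior_unit_cell[of _ m n] interior_unit_cell[of _ m' n'] v(3) unfolding mn by blast
qed

lemma parallelogram_tiling_cells: "parallelogram_tiling cells"
  unfolding parallelogram_tiling_def
proof (intro conjI exI)
  show "triangle (cell 0 0 0)" by (rule triangle_cells[OF cell_0])
  show "cell 0 0 (- 1) = (+) (X + Y) ` uminus ` cell 0 0 0" by (simp add: cell_reflect)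
qed (fact triangulation_cells parallelogram_unit_cell tiles_cells cells_eq)+

lemma measure_cell: "measure lebesgue (cell 0 0 0) = \<bar>det2 X Y\<bar> / 2"
  unfolding cell_hull measure_lebesgue_triangle by (simp add: det2_def algebra_simps)

section \<open>Interpolation on the cells\<close>

text \<open>In the coordinates \<open>s\<close>, \<open>t\<close> the function \<open>F\<close> is
  \<open>K * (2 * (s - t)\<^sup>2 - s\<^sup>2 - t\<^sup>2)\<close>. Interpolating each square
  linearly between the integers adds \<open>K * B\<close> and gives a function affine on cells,
  since the kinks lie on the lines bounding them. \<open>B\<close> vanishes on the lattice and stays
  between \<open>- 1 / 2\<close> and \<open>1 / 4\<close>, the range in the last hypothesis.\<close>

lemma overestimation_cells:
  assumes F: "F = (\<lambda>x. x$1 * x$2)"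
    and K: "F X = K" "F Y = K" "X$1 * Y$2 + X$2 * Y$1 = - 4 * K"
    and D: "\<And>b. - (1 / 2) \<le> b \<Longrightarrow> b \<le> 1 / 4 \<Longrightarrow> 0 \<le> \<Delta> + K * b \<and> \<Delta> + K * b \<le> e"
  shows "\<exists>f. overestimation e F cells f \<and> constant_deviation F cells f \<Delta>"
proof -
  define B where "B z = 2 * bump (cs z - ct z) - bump (cs z) - bump (ct z)" for z
  define f where "f z = F z + (\<Delta> + K * B z)" for z
  have Fz: "F z = K * (2 * (cs z - ct z)\<^sup>2 - (cs z)\<^sup>2 - (ct z)\<^sup>2)" for z
  proof -
    have "F z = F (cs z *\<^sub>R X + ct z *\<^sub>R Y)" using coord_expand[of z] by simp
    also have "\<dots> = (cs z)\<^sup>2 * F X + (ct z)\<^sup>2 * F Y + cs z * ct z * (X$1 * Y$2 + X$2 * Y$1)"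
      unfolding F by (simp add: power2_eq_square algebra_simps)
    finally show ?thesis unfolding K by (simp add: power2_eq_square algebra_simps)
  qed
  have Bcell: "- (1 / 2) \<le> B z \<and> B z \<le> 1 / 4" for z
  proof
    show "- (1 / 2) \<le> B z"
      using bump_bounds[of "cs z - ct z"] bump_bounds[of "cs z"] bump_bounds[of "ct z"] by (simp add: B_def)
    obtain m n k where z: "z \<in> cell m n k" "k = m - n \<or> k = m - n - 1"
      using cells_cover[of z] unfolding cells_def by blast
    define u v where "u = cs z - of_int m" and "v = ct z - of_int n"
    have uv: "0 \<le> u" "u \<le> 1" "0 \<le> v" "v \<le> 1" using z(1) by (auto simp: cell_def u_def v_def)
    have b: "bump (cs z) = u * (1 - u)" "bump (ct z) = v * (1 - v)"
      "bump (cs z - ct z) = (cs z - ct z - of_int k) * (1 - (cs z - ct z - of_int k))"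
      using z(1) unfolding cell_def u_def v_def by (auto intro!: bump_eq)
    from z(2) show "B z \<le> 1 / 4"
    proof
      assume k: "k = m - n"
      then have "cs z - ct z - of_int k = u - v" by (simp add: u_def v_def)
      moreover have "v \<le> u" using z(1) k by (simp add: cell_def u_def v_def)
      ultimately show ?thesis unfolding B_def b using bump_combination_le[of v u] uv by simp
    next
      assume k: "k = m - n - 1"
      \<comment> \<open>As \<open>r * (1 - r)\<close> is symmetric about \<open>1 / 2\<close>, this
        is the previous case with \<open>u\<close> and \<open>v\<close> exchanged.\<close>
      then have "cs z - ct z - of_int k = 1 - (v - u)" by (simp add: u_def v_def)
      moreover have "u \<le> v" using z(1) k by (simp add: cell_def u_def v_def)
      ultimately show ?thesis unfolding B_def b using bump_combination_le[of u v] uv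
        by (simp add: mult.commute)
    qed
  qed
  have cont: "continuous_on UNIV f"
    unfolding f_def B_def F
    by (intro continuous_intros continuous_on_compose2[OF continuous_on_bump]) auto
  have aff: "affine_function_on S f" if S: "S \<in> cells" for S
  proof -
    obtain p q where p: "\<And>z. cs z = p \<bullet> z" and q: "\<And>z. ct z = q \<bullet> z"
      using coord_inner by blast
    obtain m n k where z: "S = cell m n k" using S unfolding cells_def by blast
    have "f z = (K *\<^sub>R ((2 * (2 * of_int k + 1)) *\<^sub>R (p - q) - (2 * of_int m + 1) *\<^sub>R p - (2 * of_int n + 1) *\<^sub>R q)) \<bullet> z
        + (\<Delta> - K * (2 * of_int k * (of_int k + 1) - of_int m * (of_int m + 1) - of_int n * (of_int n + 1)))"
      if "z \<in> S" for z
    proof -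
      have b: "bump (cs z) = (cs z - of_int m) * (1 - (cs z - of_int m))"
        "bump (ct z) = (ct z - of_int n) * (1 - (ct z - of_int n))"
        "bump (cs z - ct z) = (cs z - ct z - of_int k) * (1 - (cs z - ct z - of_int k))"
        using that unfolding z cell_def by (auto intro!: bump_eq)
      \<comment> \<open>On the cell \<open>r\<^sup>2 + bump r\<close> is the chord
        \<open>(2 * k + 1) * r - k * (k + 1)\<close> for \<open>r = cs z - ct z\<close>, and
        likewise for the other two coordinates.\<close>
      have "f z = \<Delta> + K * (2 * ((2 * of_int k + 1) * (cs z - ct z) - of_int k * (of_int k + 1))
          - ((2 * of_int m + 1) * cs z - of_int m * (of_int m + 1))
          - ((2 * of_int n + 1) * ct z - of_int n * (of_int n + 1)))"
        unfolding f_def Fz B_def b by (simp add: power2_eq_square algebra_simps)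
      then show ?thesis unfolding p q by (simp add: inner_diff_left algebra_simps)
    qed
    then show ?thesis unfolding affine_function_on_def by blast
  qed
  have "overestimation e F cells f"
    unfolding overestimation_def continuous_pwl_def using cont aff D Bcell by (simp add: f_def)
  moreover have "constant_deviation F cells f \<Delta>"
    unfolding constant_deviation_def vertices_def
  proof clarify
    fix v S assume S: "S \<in> cells" and v: "v extreme_point_of S"
    \<comment> \<open>Extreme points of cells are lattice points; their coordinates are integers,
      where all three bumps vanish.\<close>
    have lat: "\<exists>i j. cs v = of_int i \<and> ct v = of_int j"
      if w: "w \<in> lattice" and vw: "v - w \<in> {0, X, X + Y, - X, - (X + Y)}" for w
    proof -
      obtain m n where w': "w = of_int m *\<^sub>R X + of_int n *\<^sub>R Y" using w unfolding lattice_def by blast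
      have "\<exists>i j. cs (v - w) = of_int i \<and> ct (v - w) = of_int j"
        using vw by (elim insertE) (auto intro: exI[of _ "0::int"] exI[of _ "1::int"] exI[of _ "-1::int"])
      then obtain i j where "cs (v - w) = of_int i" "ct (v - w) = of_int j" by blast
      then have "cs v = of_int (i + m)" "ct v = of_int (j + n)" by (simp_all add: w')
      then show ?thesis by blast
    qed
    from S have "\<exists>i j. cs v = of_int i \<and> ct v = of_int j"
    proof (cases rule: cells_hull)
      case (1 w)
      then have "v \<in> {w, w + X, w + (X + Y)}" using v extreme_point_of_convex_hull by blast
      then show ?thesis using lat[OF 1(1)] by auto
    next
      case (2 w)
      then have "v \<in> {w, w - X, w - (X + Y)}" using v extreme_point_of_convex_hull by blast
      then show ?thesis using lat[OF 2(1)] by auto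
    qed
    then obtain i j where "cs v = of_int i" "ct v = of_int j" by blast
    then have "B v = 0"
      unfolding B_def using bump_of_int[of i] bump_of_int[of j] bump_of_int[of "i - j"] by simp
    then show "f v - F v = \<Delta>" by (simp add: f_def)
  qed
  ultimately show ?thesis by blast
qed

end

section \<open>Optimality\<close>

lemma parallelogram_tiling_density:
  assumes "parallelogram_tiling \<T>" "S \<in> \<T>"
  shows "triangle_density \<T> = ereal (1 / measure lebesgue S)"
proof -
  obtain a b c where "congruent_triangulation \<T> a b c"
    using parallelogram_tiling_congruent[OF assms(1)] .
  then interpret congruent_triangulation \<T> a b c .
  show ?thesis unfolding triangle_density_eq measure_triangle[OF assms(2)] ..
qed

lemma optimal_density_eq: "1 / (4 * sqrt 3 / 3 * e) = sqrt 3 / (4 * e)"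
proof -
  have "1 / (4 * sqrt 3 / 3 * e) = (sqrt 3 * sqrt 3) / (4 * sqrt 3 * e)" by simp
  also have "\<dots> = sqrt 3 / (4 * e)" by (simp del: real_sqrt_mult_self)
  finally show ?thesis .
qed

lemma overestimation_density:
  assumes F: "F = (\<lambda>x. x$1 * x$2)" and e: "e > 0"
    and T: "parallelogram_tiling \<T>" and f: "overestimation e F \<T> f"
  shows "ereal (sqrt 3 / (4 * e)) \<le> triangle_density \<T>"
    and "triangle_density \<T> = ereal (sqrt 3 / (4 * e)) \<Longrightarrow>
      (\<forall>S\<in>\<T>. measure lebesgue S = 4 * sqrt 3 / 3 * e) \<and>
      (constant_deviation F \<T> f (2 * e / 3) \<or> constant_deviation F \<T> f (e / 3))"
proof -
  obtain a b c where "congruent_triangulation \<T> a b c"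
    using parallelogram_tiling_congruent[OF T] .
  then interpret congruent_triangulation \<T> a b c .
  define A where "A = \<bar>det2 (b - a) (c - a)\<bar> / 2"
  have A0: "0 < A" using nondeg by (simp add: A_def)
  have m0: "0 < 4 * sqrt 3 / 3 * e" using e by simp
  note area = overestimation_area[OF F f e, folded A_def]
  note density = triangle_density_eq[folded A_def]
  show "ereal (sqrt 3 / (4 * e)) \<le> triangle_density \<T>"
    unfolding density optimal_density_eq[symmetric] ereal_less_eq
    by (rule divide_left_mono[OF area(1)]) (use A0 m0 in auto)
  assume "triangle_density \<T> = ereal (sqrt 3 / (4 * e))"
  then have "1 / A = 1 / (4 * sqrt 3 / 3 * e)"
    unfolding density optimal_density_eq by simp
  then have A: "A = 4 * sqrt 3 / 3 * e" using A0 m0 by (metis divide_inverse inverse_eq_iff_eq mult_1)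
  show "(\<forall>S\<in>\<T>. measure lebesgue S = 4 * sqrt 3 / 3 * e) \<and>
      (constant_deviation F \<T> f (2 * e / 3) \<or> constant_deviation F \<T> f (e / 3))"
    using measure_triangle[folded A_def] A area(2) by auto
qed

text \<open>The edges \<open>X\<close>, \<open>Y\<close> and \<open>X + Y\<close> realise the
  extremal values \<open>K\<close>, \<open>K\<close> and \<open>- 2 * K\<close>, with either sign of
  \<open>K\<close>. Both deviations are wanted: \<open>e / 3\<close> becomes
  \<open>- 2 * e / 3\<close> for underestimations.\<close>

lemma optimal_overestimation_exists:
  assumes F: "F = (\<lambda>x. x$1 * x$2)" and e: "e > 0" and d: "\<Delta> = 2 * e / 3 \<or> \<Delta> = e / 3"
  shows "\<exists>\<T> f. parallelogram_tiling \<T> \<and> overestimation e F \<T> f \<and>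
    triangle_density \<T> = ereal (sqrt 3 / (4 * e)) \<and> constant_deviation F \<T> f \<Delta>"
proof -
  \<comment> \<open>With this sign \<open>\<Delta> + K * b\<close> runs exactly through the interval
    from \<open>0\<close> to \<open>e\<close> as \<open>b\<close> runs from \<open>- 1 / 2\<close>
    to \<open>1 / 4\<close>.\<close>
  define K where "K = (if \<Delta> = 2 * e / 3 then 4 * e / 3 else - (4 * e / 3))"
  define X :: "real^2" where "X = vector [1, K]"
  \<comment> \<open>The numbers \<open>2 + sqrt 3\<close> and \<open>2 - sqrt 3\<close> have product
    \<open>1\<close>, which gives \<open>F Y = K\<close>, and sum \<open>4\<close>, which gives the
    mixed term \<open>- 4 * K\<close>.\<close>
  define Y :: "real^2" where "Y = vector [- (2 + sqrt 3), - K * (2 - sqrt 3)]"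
  have K: "F X = K" "F Y = K" "X$1 * Y$2 + X$2 * Y$1 = - 4 * K"
    unfolding F X_def Y_def by (simp_all add: algebra_simps)
  have det: "det2 X Y = 2 * sqrt 3 * K"
    unfolding det2_def X_def Y_def by (simp add: algebra_simps)
  have K0: "\<bar>K\<bar> = 4 * e / 3" using e by (simp add: K_def)
  interpret lattice_basis X Y
    by standard (use det K0 e in auto)
  have "0 \<le> \<Delta> + K * b \<and> \<Delta> + K * b \<le> e" if "- (1 / 2) \<le> b" "b \<le> 1 / 4" for b
  proof -
    have "e * - (1 / 2) \<le> e * b" "e * b \<le> e * (1 / 4)"
      using that e by (intro mult_left_mono; simp)+
    moreover have "\<Delta> = 2 * e / 3 \<and> K * b = 4 / 3 * (e * b) \<or> \<Delta> = e / 3 \<and> K * b = - (4 / 3 * (e * b))"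
      using d e by (auto simp: K_def)
    ultimately show ?thesis by linarith
  qed
  from overestimation_cells[OF F K this]
  obtain f where f: "overestimation e F cells f" "constant_deviation F cells f \<Delta>" by blast
  have "measure lebesgue (cell 0 0 0) = 4 * sqrt 3 / 3 * e"
    unfolding measure_cell det using K0 by (simp add: abs_mult)
  then have "triangle_density cells = ereal (sqrt 3 / (4 * e))"
    using parallelogram_tiling_density[OF parallelogram_tiling_cells cell_0]
    by (simp only: optimal_density_eq)
  then show ?thesis using parallelogram_tiling_cells f by blast
qed

lemma optimal_density_overestimation:
  assumes F: "F = (\<lambda>x. x$1 * x$2)" and e: "e > 0"
  shows "optimal_density (overestimation e F) = ereal (sqrt 3 / (4 * e))"
proof (rule antisym)
  obtain \<T> f where "parallelogram_tiling \<T>" "overestimation e F \<T> f"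
    "triangle_density \<T> = ereal (sqrt 3 / (4 * e))"
    using optimal_overestimation_exists[OF F e] by blast
  then show "optimal_density (overestimation e F) \<le> ereal (sqrt 3 / (4 * e))"
    unfolding optimal_density_def by (intro INF_lower2[of \<T>]) auto
  show "ereal (sqrt 3 / (4 * e)) \<le> optimal_density (overestimation e F)"
    unfolding optimal_density_def using overestimation_density(1)[OF F e] by (intro INF_greatest) auto
qed

section \<open>Underestimations and the final statement\<close>

lemma underestimation_iff_overestimation:
  "underestimation e F \<T> f \<longleftrightarrow> overestimation e F \<T> (\<lambda>x. f x + e)"
proof -
  have "continuous_on UNIV (\<lambda>x. f x + e) \<longleftrightarrow> continuous_on UNIV f"
    using continuous_on_add[of UNIV "\<lambda>x. f x + e" "\<lambda>_. - e"] continuous_on_add[of UNIV f "\<lambda>_. e"] by auto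
  moreover have "affine_function_on S (\<lambda>x. f x + e) \<longleftrightarrow> affine_function_on S f" for S
  proof -
    have "f x + e = a \<bullet> x + b \<longleftrightarrow> f x = a \<bullet> x + (b - e)" for x a b by auto
    then show ?thesis unfolding affine_function_on_def by (metis diff_add_cancel add_diff_cancel)
  qed
  ultimately show ?thesis
    unfolding underestimation_def overestimation_def continuous_pwl_def by (auto simp: algebra_simps)
qed

lemma optimal_density_underestimation:
  "optimal_density (underestimation e F) = optimal_density (overestimation e F)"
proof -
  have "(\<exists>f. overestimation e F \<T> f) \<longleftrightarrow> (\<exists>f. underestimation e F \<T> f)" for \<T>
  proof
    assume "\<exists>f. overestimation e F \<T> f"
    then obtain f where "overestimation e F \<T> f" by blast
    then have "underestimation e F \<T> (\<lambda>x. f x - e)"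
      unfolding underestimation_iff_overestimation by simp
    then show "\<exists>f. underestimation e F \<T> f" by blast
  qed (auto simp: underestimation_iff_overestimation)
  then show ?thesis unfolding optimal_density_def by simp
qed

lemma optimal_tiling_underestimation:
  "optimal_tiling (underestimation e F) \<T> f \<longleftrightarrow> optimal_tiling (overestimation e F) \<T> (\<lambda>x. f x + e)"
  unfolding optimal_tiling_def optimal_density_underestimation underestimation_iff_overestimation ..

lemma constant_deviation_shift:
  "constant_deviation F \<T> (\<lambda>x. f x + e) \<Delta> \<longleftrightarrow> constant_deviation F \<T> f (\<Delta> - e)"
  unfolding constant_deviation_def by (auto simp: algebra_simps)

theorem theorem1p4:
  fixes F :: "real^2 \<Rightarrow> real" and \<epsilon> :: real
  assumes "F = (\<lambda>x. x$1 * x$2)" and "\<epsilon> > 0"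
  shows
    "optimal_density (overestimation \<epsilon> F) = ereal (sqrt 3 / (4 * \<epsilon>)) \<and>
     (\<exists>\<T> f. optimal_tiling (overestimation \<epsilon> F) \<T> f \<and>
        constant_deviation F \<T> f (2 * \<epsilon> / 3)) \<and>
     (\<forall>\<T> f. optimal_tiling (overestimation \<epsilon> F) \<T> f \<longrightarrow>
        (\<forall>S\<in>\<T>. measure lebesgue S = 4 * sqrt 3 / 3 * \<epsilon>) \<and>
        (constant_deviation F \<T> f (2 * \<epsilon> / 3) \<or> constant_deviation F \<T> f (\<epsilon> / 3))) \<and>
     optimal_density (underestimation \<epsilon> F) = ereal (sqrt 3 / (4 * \<epsilon>)) \<and>
     (\<exists>\<T> f. optimal_tiling (underestimation \<epsilon> F) \<T> f \<and>
        constant_deviation F \<T> f (- (2 * \<epsilon> / 3))) \<and>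
     (\<forall>\<T> f. optimal_tiling (underestimation \<epsilon> F) \<T> f \<longrightarrow>
        (\<forall>S\<in>\<T>. measure lebesgue S = 4 * sqrt 3 / 3 * \<epsilon>) \<and>
        (constant_deviation F \<T> f (- (2 * \<epsilon> / 3)) \<or> constant_deviation F \<T> f (- (\<epsilon> / 3))))"
proof -
  note density = optimal_density_overestimation[OF assms]
  have ex: "\<exists>\<T> f. optimal_tiling (overestimation \<epsilon> F) \<T> f \<and> constant_deviation F \<T> f \<Delta>"
    if "\<Delta> = 2 * \<epsilon> / 3 \<or> \<Delta> = \<epsilon> / 3" for \<Delta>
    using optimal_overestimation_exists[OF assms that] unfolding optimal_tiling_def density by blast
  have opt: "(\<forall>S\<in>\<T>. measure lebesgue S = 4 * sqrt 3 / 3 * \<epsilon>) \<and>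
      (constant_deviation F \<T> f (2 * \<epsilon> / 3) \<or> constant_deviation F \<T> f (\<epsilon> / 3))"
    if "optimal_tiling (overestimation \<epsilon> F) \<T> f" for \<T> f
    using overestimation_density(2)[OF assms] that unfolding optimal_tiling_def density by blast
  have shift: "2 * \<epsilon> / 3 - \<epsilon> = - (\<epsilon> / 3)" "\<epsilon> / 3 - \<epsilon> = - (2 * \<epsilon> / 3)" by simp_all
  have "\<exists>\<T> f. optimal_tiling (underestimation \<epsilon> F) \<T> f \<and> constant_deviation F \<T> f (- (2 * \<epsilon> / 3))"
  proof -
    \<comment> \<open>Subtracting \<epsilon> lowers all deviations by \<epsilon>, so the mirrored
      optimum with deviation \<open>\<epsilon> / 3\<close> is the one to start from.\<close>
    obtain \<T> f where f: "optimal_tiling (overestimation \<epsilon> F) \<T> f" "constant_deviation F \<T> f (\<epsilon> / 3)"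
      using ex[of "\<epsilon> / 3"] by blast
    have "optimal_tiling (underestimation \<epsilon> F) \<T> (\<lambda>x. f x - \<epsilon>)"
      using f(1) by (simp add: optimal_tiling_underestimation)
    moreover have "constant_deviation F \<T> (\<lambda>x. f x - \<epsilon>) (- (2 * \<epsilon> / 3))"
      using constant_deviation_shift[of F \<T> f "- \<epsilon>" "- (2 * \<epsilon> / 3)"] f(2) by simp
    ultimately show ?thesis by blast
  qed
  moreover have "(\<forall>S\<in>\<T>. measure lebesgue S = 4 * sqrt 3 / 3 * \<epsilon>) \<and>
      (constant_deviation F \<T> f (- (2 * \<epsilon> / 3)) \<or> constant_deviation F \<T> f (- (\<epsilon> / 3)))"
    if "optimal_tiling (underestimation \<epsilon> F) \<T> f" for \<T> f
    using opt[OF that[unfolded optimal_tiling_underestimation]]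
    unfolding constant_deviation_shift shift by blast
  ultimately show ?thesis
    using density ex opt optimal_density_underestimation by simp
qed

end
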